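(* Let $A(k,x)$ be a measurable and bounded function on $\mathbb{R}^2$, and for bounded measurable functions $f$ of compact support on $(0,\infty)$ let $(Tf)(k)=\int_0^\infty A(k,x)f(x)\,dx$. Suppose that $T$ satisfies $\|Tf\|_2\le C\|f\|_2$, with a constant $C$, for all bounded measurable functions $f$ of compact support. For a function $f$ let $$Mf(k)=\sup_{N>0}\left|\int_0^NA(k,x)f(x)\,dx\right|.$$ Then for every $q>2$ and $p$ with $q^{-1}+p^{-1}=1$ there is a constant $C_q$ such that $$\|Mf\|_q\le C_q\|f\|_{pq}\quad\text{for every }f\in L_{pq}$$ (hence, in particular, $\|Mf\|_q\le C_q\|f\|_p$, with a possibly different constant $C_q$, for $f\in L_p$). As a consequence, the integral $\int_0^NA(k,x)f(x)\,dx$ converges as $N\to\infty$ for almost every value of $k$ if $f\in L_{pq}$ (and in particular if $f\in L_p$, $1\le p<2$).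
   Context: $\|\cdot\|_q$ denotes the $L^q$ norm. Lorentz spaces: for a measurable function $f$ let $f^*(t)=\inf\{s: m\{x: |f(x)|>s\}\le t\}$ ($m$ is Lebesgue measure) be its non-increasing rearrangement, and let $$\|f\|^*_{pq}=\left(\frac{q}{p}\int_0^\infty\left[t^{\frac1p}f^*(t)\right]^q\frac{dt}{t}\right)^{\frac1q}.$$ $f\in L_{pq}$ (here on $(0,\infty)$) iff $\|f\|^*_{pq}<\infty$. For $1<p<\infty$, $1<q\le\infty$, $\|\cdot\|_{pq}$ is a norm on $L_{pq}$ equivalent to $\|\cdot\|^*_{pq}$, with $\|f\|^*_{pq}\le\|f\|_{pq}\le\frac{p}{p-1}\|f\|^*_{pq}$. *)

theory Defs
  imports "HOL-Analysis.Analysis"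
begin

text \<open>
  Functions on \<open>(0,\<infinity>)\<close> are functions on the reals of which only the values on \<open>{0<..}\<close> are used.
  Norms take values in the extended nonnegative reals, so that they are defined for every function.
\<close>

definition epowr :: "ennreal \<Rightarrow> real \<Rightarrow> ennreal" where \<comment> \<open>intended for exponents \<open>a > 0\<close> only\<close>
  "epowr x a = (if x = top then top else ennreal (enn2real x powr a))"

definition eLp_norm :: "real \<Rightarrow> 'a measure \<Rightarrow> ('a \<Rightarrow> ennreal) \<Rightarrow> ennreal" where
  "eLp_norm q M g = epowr (\<integral>\<^sup>+x. epowr (g x) q \<partial>M) (1 / q)"

abbreviation Lp_norm :: "real \<Rightarrow> 'a measure \<Rightarrow> ('a \<Rightarrow> complex) \<Rightarrow> ennreal" where
  "Lp_norm q M f \<equiv> eLp_norm q M (\<lambda>x. ennreal (cmod (f x)))"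

definition Lp_space :: "real \<Rightarrow> (real \<Rightarrow> complex) set" where
  "Lp_space p = {f \<in> borel_measurable (lebesgue_on {0<..}). Lp_norm p (lebesgue_on {0<..}) f < top}"

text \<open>
  In the rearrangement \<open>s\<close> ranges over \<open>[0,\<infinity>]\<close>: a negative \<open>s\<close> never qualifies, because
  \<open>(0,\<infinity>)\<close> has infinite measure, and \<open>s = \<infinity>\<close> always does, which is the convention that the infimum
  of the empty set is \<open>\<infinity>\<close>.
\<close>

definition rearrangement :: "(real \<Rightarrow> complex) \<Rightarrow> real \<Rightarrow> ennreal" where
  "rearrangement f t =
     Inf {s. emeasure lebesgue {x \<in> {0<..}. ennreal (cmod (f x)) > s} \<le> ennreal t}"

definition rearrangement_avg :: "(real \<Rightarrow> complex) \<Rightarrow> real \<Rightarrow> ennreal" where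
  "rearrangement_avg f t =
     ennreal (1 / t) * (\<integral>\<^sup>+s. rearrangement f s \<partial>lebesgue_on {0<..<t})"

definition lorentz_functional :: "real \<Rightarrow> real \<Rightarrow> (real \<Rightarrow> ennreal) \<Rightarrow> ennreal" where
  "lorentz_functional p q g =
     epowr (ennreal (q / p) *
            (\<integral>\<^sup>+t. epowr (ennreal (t powr (1 / p)) * g t) q * ennreal (1 / t) \<partial>lebesgue_on {0<..}))
       (1 / q)"

definition lorentz_qnorm :: "real \<Rightarrow> real \<Rightarrow> (real \<Rightarrow> complex) \<Rightarrow> ennreal" where
  "lorentz_qnorm p q f = lorentz_functional p q (rearrangement f)"

text \<open>
  The norm on the Lorentz space is the usual one (Stein and Weiss), in which the rearrangement
  \<open>f\<^sup>*\<close> is replaced by its average \<open>f\<^sup>*\<^sup>*(t) = 1/t \<integral>\<^sub>0\<^sup>t f\<^sup>*(s) ds\<close>; for \<open>1 < p\<close> and \<open>1 < q\<close> it lies between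
  \<^term>\<open>lorentz_qnorm p q f\<close> and \<open>p / (p - 1)\<close> times that functional.
\<close>

definition lorentz_norm :: "real \<Rightarrow> real \<Rightarrow> (real \<Rightarrow> complex) \<Rightarrow> ennreal" where
  "lorentz_norm p q f = lorentz_functional p q (rearrangement_avg f)"

definition lorentz_space :: "real \<Rightarrow> real \<Rightarrow> (real \<Rightarrow> complex) set" where
  "lorentz_space p q = {f \<in> borel_measurable (lebesgue_on {0<..}). lorentz_qnorm p q f < top}"

text \<open>Compact support means support in a compact subset of the open half-line.\<close>

definition bounded_compact_support :: "(real \<Rightarrow> complex) set" where
  "bounded_compact_support =
     {f \<in> borel_measurable (lebesgue_on {0<..}).
        bounded (f ` {0<..}) \<and> (\<exists>K. compact K \<and> K \<subseteq> {0<..} \<and> (\<forall>x\<in>{0<..} - K. f x = 0))}"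

definition integral_op :: "(real \<Rightarrow> real \<Rightarrow> complex) \<Rightarrow> (real \<Rightarrow> complex) \<Rightarrow> real \<Rightarrow> complex" where
  "integral_op A f k = (LINT x:{0<..}|lebesgue. A k x * f x)"

definition partial_integral ::
    "(real \<Rightarrow> real \<Rightarrow> complex) \<Rightarrow> (real \<Rightarrow> complex) \<Rightarrow> real \<Rightarrow> real \<Rightarrow> complex" where
  "partial_integral A f k N = (LINT x:{0<..N}|lebesgue. A k x * f x)"

definition maximal_op :: "(real \<Rightarrow> real \<Rightarrow> complex) \<Rightarrow> (real \<Rightarrow> complex) \<Rightarrow> real \<Rightarrow> ennreal" where
  "maximal_op A f k = (SUP N\<in>{0<..}. ennreal (cmod (partial_integral A f k N)))"

text \<open>
  Bochner integrals of non-integrable functions are \<open>0\<close> by convention, so convergence of the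
  improper integral requires the partial integrals to exist.
\<close>

definition integral_converges ::
    "(real \<Rightarrow> real \<Rightarrow> complex) \<Rightarrow> (real \<Rightarrow> complex) \<Rightarrow> real \<Rightarrow> bool" where
  "integral_converges A f k \<longleftrightarrow>
     (\<forall>N>0. set_integrable lebesgue {0<..N} (\<lambda>x. A k x * f x)) \<and>
     (\<exists>L. (partial_integral A f k \<longlongrightarrow> L) at_top)"

end

theory Submission
  imports Defs
begin

text \<open>
  Two facts about the operator are combined: it is bounded on \<open>L\<^sup>2\<close>, and, the kernel being bounded
  by \<open>B\<close>, it maps \<open>L\<^sup>1\<close> into \<open>L\<^sup>\<infinity>\<close>.

  \<^emph>\<open>One height.\<close>  Let \<open>\<bar>g\<bar> \<le> a\<close> on a set \<open>E\<close> of measure at most \<open>m\<close>, and \<open>g = 0\<close> elsewhere.  For every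
  depth \<open>n\<close> cut \<open>E\<close> from left to right into cells of measure \<open>m / 2^n\<close>, each cell of depth \<open>n\<close> being
  halved at depth \<open>n + 1\<close>.  The part of \<open>E\<close> to the left of \<open>N\<close> is approximated by the union of the full
  cells of depth \<open>n\<close> in it, and passing from \<open>n\<close> to \<open>n + 1\<close> adds at most one cell.  Hence every partial
  integral of \<open>g\<close> is at most \<open>\<Sum>\<^sub>n h\<^sub>n\<close>, where \<open>h\<^sub>n(k)\<close> is the largest \<open>\<bar>T(g 1\<^sub>c)(k)\<bar>\<close> over the cells \<open>c\<close> of
  depth \<open>n\<close> (lemma \<open>T_cutoff_le\<close>).  Because the cells are disjoint, the \<open>L\<^sup>2\<close> norm of \<open>h\<^sub>n\<close> is at most
  \<open>C a m^(1/2)\<close>, uniformly in \<open>n\<close>; because they are small, \<open>h\<^sub>n \<le> B a m / 2^n\<close>.  The first bound alone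
  does not sum over \<open>n\<close>, but for an exponent \<open>q > 2\<close> the second one contributes a geometric factor.

  \<^emph>\<open>All heights.\<close>  Cut \<open>f\<close> at the values \<open>f\<^sup>*(2^j)\<close> of its rearrangement.  This gives pieces of height
  at most \<open>a\<^sub>j = f\<^sup>*(2^(j-1))\<close> on sets \<open>E\<^sub>j\<close> of measure at most \<open>2^j\<close>, and the Lorentz norm to the power \<open>q\<close>
  controls \<open>\<Sum>\<^sub>j a\<^sub>j^q 2^(j(q-1))\<close>.  The pieces are added by means of a pointwise inequality (lemma
  \<open>epowr_sum_le_pairs\<close>) which bounds \<open>(\<Sum>\<^sub>j h\<^sub>j)^q\<close> by the sum of \<open>2^(e(j-i)) h\<^sub>i^(q-2) h\<^sub>j\<^sup>2\<close> over the
  pairs \<open>i \<le> j\<close>.  In such a pair the uniform bound is used for \<open>h\<^sub>i\<close>, which belongs to the smaller set,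
  and the \<open>L\<^sup>2\<close> bound for \<open>h\<^sub>j\<close>; the two together gain \<open>2^(-(j-i)(q-2)/q)\<close>, which beats the weight if \<open>e\<close> is
  small.  The outcome is lemma \<open>majorant_bound\<close>; it is a Marcinkiewicz interpolation between
  \<open>L\<^sup>1 \<rightarrow> L\<^sup>\<infinity>\<close> and \<open>L\<^sup>2 \<rightarrow> L\<^sup>2\<close> in which the loss at the second endpoint is absorbed by the sum over \<open>n\<close>.

  \<^emph>\<open>Convergence.\<close>  The majorant is finite for almost every \<open>k\<close>.  For such \<open>k\<close> the partial integrals of
  \<open>f\<close> are sums over \<open>j\<close> of the partial integrals of the pieces, each of which converges as \<open>N \<rightarrow> \<infinity>\<close>
  since a piece is integrable, and the sums are dominated uniformly in \<open>N\<close>; so Tannery's theorem applies.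

  \<^emph>\<open>Lebesgue spaces.\<close>  For \<open>p < q\<close> the \<open>L\<^sup>p\<close> norm dominates the Lorentz functional, because
  \<open>\<integral> f\<^sup>*(t)^p dt \<le> \<integral> \<bar>f\<bar>^p\<close>.  An exponent \<open>1 < p < 2\<close> thus reduces to the Lorentz space with the
  conjugate \<open>q > 2\<close>, and for \<open>p = 1\<close> the integral converges absolutely.
\<close>

section \<open>Real powers and geometric sums of extended nonnegative reals\<close>

lemma epowr_ennreal: "0 \<le> x \<Longrightarrow> epowr (ennreal x) a = ennreal (x powr a)"
  by (simp add: epowr_def)

lemma epowr_0 [simp]: "epowr 0 a = 0"
  by (simp add: epowr_def)

lemma epowr_top [simp]: "epowr top a = top"
  by (simp add: epowr_def)

lemma epowr_mono: "x \<le> y \<Longrightarrow> 0 \<le> a \<Longrightarrow> epowr x a \<le> epowr y a"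
  by (cases x; cases y) (auto simp: epowr_ennreal top_unique intro!: ennreal_leI powr_mono2)

lemma epowr_mult: "0 < a \<Longrightarrow> epowr (x * y) a = epowr x a * epowr y a"
proof (cases x; cases y)
  fix r s assume "0 < a" "x = ennreal r" "y = ennreal s" "0 \<le> r" "0 \<le> s"
  then show ?thesis
    by (simp add: epowr_ennreal ennreal_mult[symmetric] powr_mult)
qed (auto simp: epowr_ennreal ennreal_mult_top ennreal_top_mult)

lemma epowr_add: "0 < a \<Longrightarrow> 0 < b \<Longrightarrow> epowr x (a + b) = epowr x a * epowr x b"
  by (cases x) (auto simp: epowr_ennreal powr_add ennreal_mult)

lemma epowr_epowr: "0 < a \<Longrightarrow> 0 < b \<Longrightarrow> epowr (epowr x a) b = epowr x (a * b)"
  by (cases x) (auto simp: epowr_ennreal powr_powr)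

lemma epowr_1 [simp]: "epowr x 1 = x"
  by (cases x) (auto simp: epowr_ennreal)

lemma epowr_2: "epowr x 2 = x\<^sup>2"
  by (cases x) (auto simp: epowr_ennreal ennreal_power)

lemma epowr_eq_top_iff [simp]: "epowr x a = top \<longleftrightarrow> x = top"
  by (simp add: epowr_def)

lemma measurable_epowr [measurable]:
  assumes [measurable]: "f \<in> borel_measurable M"
  shows "(\<lambda>x. epowr (f x) a) \<in> borel_measurable M"
  unfolding epowr_def by measurable

lemma epowr_le_iff: "0 < a \<Longrightarrow> epowr x a \<le> y \<longleftrightarrow> x \<le> epowr y (1 / a)"
  using epowr_mono[of "epowr x a" y "1/a"] epowr_mono[of x "epowr y (1/a)" a]
  by (auto simp: epowr_epowr)

definition geom_sum :: "real \<Rightarrow> real" where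
  "geom_sum r = (\<Sum>n. (2 powr - r) ^ n)"

lemma geom_sums:
  assumes "0 < r" shows "(\<lambda>n. 2 powr (- r * real n)) sums geom_sum r"
proof -
  have "(2::real) powr - r < 1" using assms powr_less_mono[of "- r" 0 2] by simp
  then have "summable (\<lambda>n. (2 powr - r) ^ n :: real)"
    by (intro summable_geometric) simp
  then have "(\<lambda>n. (2 powr - r) ^ n) sums geom_sum r"
    unfolding geom_sum_def by (rule summable_sums)
  moreover have "(2 powr - r) ^ n = (2::real) powr (- r * real n)" for n
    by (simp add: powr_power mult.commute)
  ultimately show ?thesis by simp
qed

lemma suminf_geom:
  assumes "0 < r" shows "(\<Sum>n. ennreal (2 powr (- r * real n))) = ennreal (geom_sum r)"
  using geom_sums[OF assms] by (intro suminf_ennreal_eq) auto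

lemma geom_sum_nonneg: "0 < r \<Longrightarrow> 0 \<le> geom_sum r"
  using geom_sums sums_le[of "\<lambda>_. 0" "\<lambda>n. 2 powr (- r * real n)"] by fastforce

lemma member_le_suminf:
  fixes x :: "nat \<Rightarrow> ennreal"
  shows "x n \<le> (\<Sum>n. x n)"
  using sum_le_suminf[of x "{n}"] by simp

text \<open>
  A countable sum costs only geometric weights: each \<open>x\<^sub>n\<close> is at most \<open>2^(-en/q)\<close> times the \<open>q\<close>-th root
  of the weighted sum of powers, and these bounds are summed.  Serves as a crude substitute for
  Minkowski's inequality.
\<close>
lemma epowr_suminf_le:
  assumes q: "0 < q" and e: "0 < e"
  shows "epowr (\<Sum>n. x n) q
    \<le> ennreal (geom_sum (e / q) powr q) * (\<Sum>n. ennreal (2 powr (e * real n)) * epowr (x n) q)"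
    (is "_ \<le> _ * ?R")
proof -
  have "x n \<le> ennreal (2 powr (- (e / q) * real n)) * epowr ?R (1 / q)" for n
  proof -
    have "ennreal (2 powr (e * real n)) * epowr (x n) q \<le> ?R"
      by (rule member_le_suminf[of "\<lambda>n. ennreal (2 powr (e * real n)) * epowr (x n) q"])
    then have "epowr (ennreal (2 powr (e * real n)) * epowr (x n) q) (1 / q) \<le> epowr ?R (1 / q)"
      using q by (intro epowr_mono) auto
    then have "ennreal (2 powr (e / q * real n)) * x n \<le> epowr ?R (1 / q)"
      using q by (simp add: epowr_mult epowr_epowr epowr_ennreal powr_powr mult.commute)
    then have "ennreal (2 powr (- (e / q) * real n)) * (ennreal (2 powr (e / q * real n)) * x n)
        \<le> ennreal (2 powr (- (e / q) * real n)) * epowr ?R (1 / q)"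
      by (rule mult_left_mono) simp
    then show ?thesis
      by (simp add: mult.assoc[symmetric] ennreal_mult[symmetric] powr_add[symmetric])
  qed
  then have "(\<Sum>n. x n) \<le> (\<Sum>n. ennreal (2 powr (- (e / q) * real n)) * epowr ?R (1 / q))"
    by (intro suminf_le) auto
  also have "\<dots> = ennreal (geom_sum (e / q)) * epowr ?R (1 / q)"
    using q e by (simp only: ennreal_suminf_multc suminf_geom divide_pos_pos)
  finally have "epowr (\<Sum>n. x n) q \<le> epowr (ennreal (geom_sum (e / q)) * epowr ?R (1 / q)) q"
    using q by (intro epowr_mono) auto
  then show ?thesis
    using q e geom_sum_nonneg[of "e / q"] by (simp add: epowr_mult epowr_epowr epowr_ennreal)
qed

lemma nn_integral_count_space_int:
  fixes h :: "int \<Rightarrow> ennreal"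
  shows "(\<integral>\<^sup>+j. h j \<partial>count_space UNIV) = (\<Sum>n. h (int_decode n))"
  using nn_integral_bij_count_space[OF bij_int_decode, of h] by (simp add: nn_integral_count_space_nat)

lemma nn_integral_count_space_int_le:
  fixes h :: "int \<Rightarrow> ennreal"
  assumes "\<And>F. finite F \<Longrightarrow> F \<noteq> {} \<Longrightarrow> sum h F \<le> X"
  shows "(\<integral>\<^sup>+j. h j \<partial>count_space UNIV) \<le> X"
  unfolding nn_integral_count_space_int
proof (rule suminf_le_const)
  fix N :: nat
  have "(\<Sum>n<N. h (int_decode n)) = sum h (int_decode ` {..<N})"
    by (subst sum.reindex) (auto intro: inj_on_subset[OF inj_int_decode])
  then show "(\<Sum>n<N. h (int_decode n)) \<le> X"
    using assms[of "int_decode ` {..<N}"] by (cases "N = 0") auto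
qed simp

lemma count_space_member_le:
  fixes h :: "int \<Rightarrow> ennreal"
  shows "h i \<le> (\<integral>\<^sup>+j. h j \<partial>count_space UNIV)"
proof -
  obtain n where "i = int_decode n" by (metis int_encode_inverse)
  then show ?thesis
    unfolding nn_integral_count_space_int
    using member_le_suminf[of "\<lambda>n. h (int_decode n)" n] by simp
qed

lemma two_sided_geom_sum:
  fixes F :: "int set"
  assumes "finite F" "0 < r"
  shows "(\<Sum>j\<in>F. 2 powr (- r * real_of_int \<bar>j - c\<bar>)) \<le> 2 * geom_sum r"
proof -
  have *: "(\<Sum>j\<in>G. 2 powr (- r * real_of_int \<bar>j - c\<bar>)) \<le> geom_sum r"
    if G: "finite G" and inj: "inj_on (\<lambda>j. nat \<bar>j - c\<bar>) G" for G
  proof -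
    have "(\<Sum>j\<in>G. 2 powr (- r * real_of_int \<bar>j - c\<bar>))
        = (\<Sum>n\<in>(\<lambda>j. nat \<bar>j - c\<bar>) ` G. 2 powr (- r * real n))"
      by (subst sum.reindex[OF inj]) (simp add: o_def)
    also have "\<dots> \<le> (\<Sum>n. 2 powr (- r * real n))"
      using geom_sums[OF assms(2)] G by (intro sum_le_suminf) (auto simp: sums_iff)
    finally show ?thesis
      using geom_sums[OF assms(2)] by (simp add: sums_iff)
  qed
  have "(\<Sum>j\<in>F. 2 powr (- r * real_of_int \<bar>j - c\<bar>))
      = (\<Sum>j\<in>F \<inter> {c..}. 2 powr (- r * real_of_int \<bar>j - c\<bar>))
      + (\<Sum>j\<in>F - {c..}. 2 powr (- r * real_of_int \<bar>j - c\<bar>))"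
    using assms(1) by (metis sum.Int_Diff)
  also have "\<dots> \<le> geom_sum r + geom_sum r"
    using assms(1) by (intro add_mono *) (auto simp: inj_on_def)
  finally show ?thesis by simp
qed

text \<open>
  Let \<open>h\<^sub>c\<close> be the largest of finitely many terms.  For \<open>j \<le> c\<close> replace two of the \<open>q\<close> factors of
  \<open>h\<^sub>j^q\<close> by \<open>h\<^sub>c\<close>, for \<open>j > c\<close> replace the other \<open>q - 2\<close>; either way a summand of the right-hand side
  appears, with weight \<open>2^(e\<bar>j-c\<bar>)\<close>.  So \<open>h\<^sub>j\<close> decays geometrically away from \<open>c\<close>, relative to the \<open>q\<close>-th
  root of the right-hand side, and the terms can be summed.
\<close>
lemma epowr_sum_le_pairs:
  fixes h :: "int \<Rightarrow> ennreal"
  assumes q: "2 < q" and e: "0 < e"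
  shows "epowr (\<integral>\<^sup>+j. h j \<partial>count_space UNIV) q \<le>
    ennreal ((2 * geom_sum (e / q)) powr q) *
    (\<Sum>d. \<integral>\<^sup>+i. ennreal (2 powr (e * real d)) * (epowr (h i) (q - 2) * (h (i + int d))\<^sup>2) \<partial>count_space UNIV)"
    (is "_ \<le> _ * ?R")
proof -
  have R: "ennreal (2 powr (e * real d)) * (epowr (h i) (q - 2) * (h (i + int d))\<^sup>2) \<le> ?R" for i d
  proof -
    let ?f = "\<lambda>d i. ennreal (2 powr (e * real d)) * (epowr (h i) (q - 2) * (h (i + int d))\<^sup>2)"
    have "?f d i \<le> (\<integral>\<^sup>+i. ?f d i \<partial>count_space UNIV)"
      by (rule count_space_member_le)
    also have "\<dots> \<le> ?R"
      by (rule member_le_suminf[of "\<lambda>d. \<integral>\<^sup>+i. ?f d i \<partial>count_space UNIV"])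
    finally show ?thesis .
  qed
  have sum_le: "sum h F \<le> ennreal (2 * geom_sum (e / q)) * epowr ?R (1 / q)"
    if F: "finite F" "F \<noteq> {}" for F
  proof -
    have "Max (h ` F) \<in> h ` F" using F by (intro Max_in) auto
    then obtain c where c: "c \<in> F" "\<And>j. j \<in> F \<Longrightarrow> h j \<le> h c"
      using F by (auto simp: image_iff) (metis F(1) Max_ge finite_imageI imageI)
    have bound: "h j \<le> ennreal (2 powr (- (e / q) * real_of_int \<bar>j - c\<bar>)) * epowr ?R (1 / q)"
      if j: "j \<in> F" for j
    proof -
      have hq: "epowr (h j) q = epowr (h j) (q - 2) * (h j)\<^sup>2"
        using epowr_add[of "q - 2" 2 "h j"] q by (simp add: epowr_2)
      let ?D = "nat \<bar>j - c\<bar>"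
      have "ennreal (2 powr (e * real ?D)) * epowr (h j) q \<le> ?R"
      proof (cases "j \<le> c")
        case True
        then have "j + int ?D = c" by simp
        have "epowr (h j) q \<le> epowr (h j) (q - 2) * (h c)\<^sup>2"
          unfolding hq using c(2)[OF j] by (intro mult_left_mono power_mono) auto
        then show ?thesis
          using R[of ?D j] \<open>j + int ?D = c\<close> by (auto intro: order_trans[OF mult_left_mono])
      next
        case False
        then have "c + int ?D = j" by simp
        have "epowr (h j) q \<le> epowr (h c) (q - 2) * (h j)\<^sup>2"
          unfolding hq using c(2)[OF j] q by (intro mult_right_mono epowr_mono) auto
        then show ?thesis
          using R[of ?D c] \<open>c + int ?D = j\<close> by (auto intro: order_trans[OF mult_left_mono])
      qed
      then have "epowr (ennreal (2 powr (e * real ?D)) * epowr (h j) q) (1 / q) \<le> epowr ?R (1 / q)"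
        using q by (intro epowr_mono) auto
      then have "ennreal (2 powr (e / q * real ?D)) * h j \<le> epowr ?R (1 / q)"
        using q by (simp add: epowr_mult epowr_epowr epowr_ennreal powr_powr mult.commute)
      then have "ennreal (2 powr (- (e / q) * real ?D)) * (ennreal (2 powr (e / q * real ?D)) * h j)
          \<le> ennreal (2 powr (- (e / q) * real ?D)) * epowr ?R (1 / q)"
        by (rule mult_left_mono) simp
      then show ?thesis
        by (simp add: mult.assoc[symmetric] ennreal_mult[symmetric] powr_add[symmetric])
    qed
    have "sum h F \<le> (\<Sum>j\<in>F. ennreal (2 powr (- (e / q) * real_of_int \<bar>j - c\<bar>)) * epowr ?R (1 / q))"
      by (intro sum_mono bound)
    also have "\<dots> = ennreal (\<Sum>j\<in>F. 2 powr (- (e / q) * real_of_int \<bar>j - c\<bar>)) * epowr ?R (1 / q)"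
      by (subst sum_distrib_right[symmetric], subst sum_ennreal) auto
    also have "\<dots> \<le> ennreal (2 * geom_sum (e / q)) * epowr ?R (1 / q)"
      using q e F by (intro mult_right_mono ennreal_leI two_sided_geom_sum) auto
    finally show ?thesis .
  qed
  have "epowr (\<integral>\<^sup>+j. h j \<partial>count_space UNIV) q
      \<le> epowr (ennreal (2 * geom_sum (e / q)) * epowr ?R (1 / q)) q"
    using q by (intro epowr_mono nn_integral_count_space_int_le sum_le) auto
  also have "\<dots> = ennreal ((2 * geom_sum (e / q)) powr q) * ?R"
    using q e geom_sum_nonneg[of "e / q"] by (simp add: epowr_mult epowr_epowr epowr_ennreal)
  finally show ?thesis .
qed

section \<open>Cells of equal measure\<close>

text \<open>
  The cells of size \<open>d\<close> are the level sets of the integer part of \<open>cumul E x / d\<close>.  Defining them by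
  integer parts instead of by cut points makes refinement a matter of arithmetic (lemma \<open>level_half\<close>)
  and keeps the cells of one size disjoint, with indices in the natural numbers, whatever the size of \<open>E\<close>.
\<close>
definition cumul :: "real set \<Rightarrow> real \<Rightarrow> real" where
  "cumul E x = measure lborel (E \<inter> {..x})"

definition level :: "real set \<Rightarrow> real \<Rightarrow> real \<Rightarrow> nat" where
  "level E d x = nat \<lfloor>cumul E x / d\<rfloor>"

definition cell :: "real set \<Rightarrow> real \<Rightarrow> nat \<Rightarrow> real set" where
  "cell E d i = {x \<in> E. level E d x = i}"

lemma finite_emeasure_Int:
  assumes "E \<in> sets borel" "emeasure lborel E < top" "A \<in> sets borel"
  shows "emeasure lborel (E \<inter> A) < top"
proof -
  have "emeasure lborel (E \<inter> A) \<le> emeasure lborel E"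
    using assms by (intro emeasure_mono) auto
  with assms show ?thesis by (simp add: le_less_trans)
qed

lemma cumul_nonneg: "0 \<le> cumul E x"
  by (simp add: cumul_def)

lemma mono_cumul:
  assumes "E \<in> sets borel" "emeasure lborel E < top"
  shows "mono (cumul E)"
proof (rule monoI)
  fix x y :: real assume "x \<le> y"
  then show "cumul E x \<le> cumul E y"
    unfolding cumul_def using finite_emeasure_Int[OF assms, of "{..y}"] assms(1)
    by (intro measure_mono_fmeasurable) (auto simp: fmeasurable_def)
qed

lemma cumul_le:
  assumes "E \<in> sets borel" "emeasure lborel E \<le> ennreal m" "0 \<le> m"
  shows "cumul E x \<le> m"
proof -
  have "emeasure lborel (E \<inter> {..x}) \<le> emeasure lborel E"
    using assms by (intro emeasure_mono) auto
  with assms have "emeasure lborel (E \<inter> {..x}) \<le> ennreal m" by simp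
  then show ?thesis
    unfolding cumul_def measure_def using assms(3) by (simp add: enn2real_leI)
qed

lemma cumul_diff:
  assumes E: "E \<in> sets borel" "emeasure lborel E < top" and "x \<le> y"
  shows "emeasure lborel (E \<inter> {x..y}) = ennreal (cumul E y - cumul E x)"
proof -
  have fin: "emeasure lborel (E \<inter> A) \<noteq> top" if "A \<in> sets borel" for A
    using finite_emeasure_Int[OF E that] by simp
  have "cumul E y = measure lborel (E \<inter> {..x}) + measure lborel (E \<inter> {x<..y})"
    unfolding cumul_def
  proof (subst measure_Union[symmetric])
    show "emeasure lborel (E \<inter> {..x}) \<noteq> \<infinity>" "emeasure lborel (E \<inter> {x<..y}) \<noteq> \<infinity>"
      using fin by auto
    have "E \<inter> {..y} = E \<inter> {..x} \<union> E \<inter> {x<..y}" using \<open>x \<le> y\<close> by auto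
    then show "measure lborel (E \<inter> {..y}) = measure lborel (E \<inter> {..x} \<union> E \<inter> {x<..y})" by simp
  qed (use E in auto)
  then have "ennreal (cumul E y - cumul E x) = emeasure lborel (E \<inter> {x<..y})"
    using fin by (simp add: cumul_def emeasure_eq_ennreal_measure)
  also have "\<dots> = emeasure lborel (E \<inter> {x..y})"
  proof (rule emeasure_eq_AE)
    show "AE z in lborel. z \<in> E \<inter> {x<..y} \<longleftrightarrow> z \<in> E \<inter> {x..y}"
      using AE_lborel_singleton[of x] by eventually_elim auto
  qed (use E in auto)
  finally show ?thesis by simp
qed

lemma cumul_measurable:
  assumes "E \<in> sets borel" "emeasure lborel E < top"
  shows "cumul E \<in> borel_measurable borel"
  using mono_cumul[OF assms] by (rule borel_measurable_mono)

lemma level_measurable: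
  assumes "E \<in> sets borel" "emeasure lborel E < top"
  shows "level E d \<in> measurable borel (count_space UNIV)"
proof -
  note cumul_measurable[OF assms, measurable]
  show ?thesis unfolding level_def by measurable
qed

lemma cell_sets:
  assumes "E \<in> sets borel" "emeasure lborel E < top"
  shows "cell E d i \<in> sets borel"
proof -
  note level_measurable[OF assms, measurable] assms(1)[measurable]
  show ?thesis unfolding cell_def by measurable
qed

lemma level_eq_iff:
  assumes "0 < d"
  shows "level E d x = i \<longleftrightarrow> real i * d \<le> cumul E x \<and> cumul E x < real (Suc i) * d"
proof -
  have "0 \<le> cumul E x / d" using cumul_nonneg assms by simp
  then have "level E d x = i \<longleftrightarrow> \<lfloor>cumul E x / d\<rfloor> = int i"
    unfolding level_def by (metis int_nat_eq nat_int zero_le_floor)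
  also have "\<dots> \<longleftrightarrow> real i * d \<le> cumul E x \<and> cumul E x < real (Suc i) * d"
    using assms by (simp add: floor_eq_iff field_simps)
  finally show ?thesis .
qed

lemma level_half: "level E (d / 2) x div 2 = level E d x"
proof -
  have "\<lfloor>2 * y\<rfloor> div 2 = \<lfloor>y\<rfloor>" for y :: real by linarith
  from this[of "cumul E x / d"] show ?thesis
    unfolding level_def by (simp add: nat_div_distrib[symmetric] mult.commute)
qed

text \<open>
  By inner regularity it suffices to bound a compact subset of the cell.  It lies between its least and
  its greatest element, which belong to the cell, so that \<open>cumul E\<close> increases by less than \<open>d\<close> from the
  one to the other.
\<close>
lemma emeasure_cell:
  assumes E: "E \<in> sets borel" "emeasure lborel E < top" and d: "0 < d"
  shows "emeasure lborel (cell E d i) \<le> ennreal d"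
proof -
  let ?M = "density lborel (indicator E)"
  let ?S = "cell E d i"
  have S: "?S \<in> sets borel" by (rule cell_sets[OF E])
  have em: "emeasure ?M A = emeasure lborel (E \<inter> A)" if "A \<in> sets borel" for A
    using that E(1) by (subst emeasure_density) (auto simp: indicator_inter_arith[symmetric])
  have "emeasure ?M ?S = (SUP T\<in>{T. T \<subseteq> ?S \<and> compact T}. emeasure ?M T)"
    using E S em[of UNIV] by (intro inner_regular) auto
  also have "\<dots> \<le> ennreal d"
  proof (rule SUP_least, safe)
    fix T assume T: "T \<subseteq> ?S" "compact T"
    show "emeasure ?M T \<le> ennreal d"
    proof (cases "T = {}")
      case False
      let ?u = "Inf T" and ?v = "Sup T"
      have uv: "?u \<in> T" "?v \<in> T"
        using T False by (auto intro!: closed_contains_Inf closed_contains_Sup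
            simp: compact_imp_closed compact_imp_bounded bounded_imp_bdd_below bounded_imp_bdd_above)
      have sub: "T \<subseteq> {?u..?v}"
        using T by (auto intro!: cInf_lower cSup_upper
            simp: compact_imp_bounded bounded_imp_bdd_below bounded_imp_bdd_above)
      then have "?u \<le> ?v" using uv by auto
      have "emeasure ?M T = emeasure lborel (E \<inter> T)"
        using T by (intro em) (simp add: borel_compact)
      also have "\<dots> \<le> emeasure lborel (E \<inter> {?u..?v})"
        using sub E by (intro emeasure_mono) auto
      also have "\<dots> = ennreal (cumul E ?v - cumul E ?u)"
        by (rule cumul_diff[OF E \<open>?u \<le> ?v\<close>])
      also have "\<dots> \<le> ennreal d"
      proof (rule ennreal_leI)
        have "level E d ?u = i" "level E d ?v = i" using uv T by (auto simp: cell_def)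
        then show "cumul E ?v - cumul E ?u \<le> d"
          using d by (auto simp: level_eq_iff algebra_simps)
      qed
      finally show ?thesis .
    qed simp
  qed
  finally show ?thesis
    using em[OF S] by (simp add: cell_def Int_def)
qed

section \<open>A piece of bounded height on a set of finite measure\<close>

text \<open>
  The \<open>L\<^sup>2\<close> bound is assumed only for functions supported in a compact subset of the open half-line;
  \<open>L2_bound\<close> below extends it to all integrable functions on the half-line by Fatou's lemma.
\<close>
locale L2_kernel =
  fixes K :: "real \<Rightarrow> real \<Rightarrow> complex" and B C :: real
  assumes K_pair_measurable: "(\<lambda>(k, x). K k x) \<in> borel_measurable (lborel \<Otimes>\<^sub>M lborel)"
    and K_bound: "cmod (K k x) \<le> B"
    and L2_bound_compact: "\<And>g l u. g \<in> borel_measurable borel \<Longrightarrow> bounded (range g) \<Longrightarrow> 0 < l \<Longrightarrow>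
      (\<And>x. x \<notin> {l..u} \<Longrightarrow> g x = 0) \<Longrightarrow>
      (\<integral>\<^sup>+k. (ennreal (cmod (LINT x|lborel. K k x * g x)))\<^sup>2 \<partial>lborel)
        \<le> ennreal (C\<^sup>2) * (\<integral>\<^sup>+x. (ennreal (cmod (g x)))\<^sup>2 \<partial>lborel)"
begin

definition T :: "(real \<Rightarrow> complex) \<Rightarrow> real \<Rightarrow> complex" where
  "T g k = (LINT x|lborel. K k x * g x)"

lemma B_nonneg: "0 \<le> B"
  using K_bound[of 0 0] norm_ge_zero order_trans by blast

lemma K_measurable [measurable]: "K k \<in> borel_measurable borel"
proof -
  have "(\<lambda>x. (\<lambda>(k, x). K k x) (k, x)) \<in> borel_measurable lborel"
    by (rule measurable_compose[OF measurable_Pair1' K_pair_measurable]) simp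
  then show ?thesis by simp
qed

lemma T_integrable:
  assumes g: "integrable lborel g"
  shows "integrable lborel (\<lambda>x. K k x * g x)"
proof (rule Bochner_Integration.integrable_bound[of _ "\<lambda>x. B * cmod (g x)"])
  show "integrable lborel (\<lambda>x. B * cmod (g x))" using g by simp
  have [measurable]: "g \<in> borel_measurable borel" using g by auto
  show "(\<lambda>x. K k x * g x) \<in> borel_measurable lborel" by measurable
  show "AE x in lborel. cmod (K k x * g x) \<le> norm (B * cmod (g x))"
    using K_bound B_nonneg by (auto simp: norm_mult intro!: mult_right_mono)
qed

lemma T_add:
  assumes "integrable lborel f" "integrable lborel g"
  shows "T (\<lambda>x. f x + g x) k = T f k + T g k"
  unfolding T_def using assms[THEN T_integrable]
  by (simp add: distrib_left Bochner_Integration.integral_add)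

lemma T_measurable:
  assumes [measurable]: "g \<in> borel_measurable borel"
  shows "T g \<in> borel_measurable borel"
proof -
  note K_pair_measurable[measurable]
  have "(\<lambda>(k, x). K k x * g x) \<in> borel_measurable (lborel \<Otimes>\<^sub>M lborel)"
    by measurable
  then have "(\<lambda>k. LINT x|lborel. K k x * g x) \<in> borel_measurable lborel"
    by (rule lborel.borel_measurable_lebesgue_integral)
  then show ?thesis by (simp add: T_def[abs_def])
qed

lemma norm_T_le:
  assumes g: "integrable lborel g"
  shows "cmod (T g k) \<le> B * (LINT x|lborel. cmod (g x))"
proof -
  have "cmod (T g k) \<le> (LINT x|lborel. cmod (K k x * g x))"
    unfolding T_def by (rule integral_norm_bound)
  also have "\<dots> \<le> (LINT x|lborel. B * cmod (g x))"
    using g K_bound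
    by (intro integral_mono integrable_norm[OF T_integrable[OF g]])
      (auto simp: norm_mult intro!: mult_right_mono)
  finally show ?thesis by simp
qed

lemma L2_bound:
  assumes g: "integrable lborel g" and supp: "\<And>x. x \<le> 0 \<Longrightarrow> g x = 0"
  shows "(\<integral>\<^sup>+k. (ennreal (cmod (T g k)))\<^sup>2 \<partial>lborel)
    \<le> ennreal (C\<^sup>2) * (\<integral>\<^sup>+x. (ennreal (cmod (g x)))\<^sup>2 \<partial>lborel)"
proof -
  have [measurable]: "g \<in> borel_measurable borel" using g by auto
  define G :: "nat \<Rightarrow> real \<Rightarrow> complex" where
    "G n x = (if 1 / real (Suc n) \<le> x \<and> x \<le> real n \<and> cmod (g x) \<le> real n then g x else 0)" for n x
  have [measurable]: "G n \<in> borel_measurable borel" for n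
    unfolding G_def[abs_def] by measurable
  have Gle: "cmod (G n x) \<le> cmod (g x)" for n x by (simp add: G_def)
  have Gint: "integrable lborel (G n)" for n
    by (rule Bochner_Integration.integrable_bound[OF g]) (auto simp: Gle)
  have Glim: "(\<lambda>n. G n x) \<longlonglongrightarrow> g x" for x
  proof (cases "x \<le> 0")
    case True
    then have "G n x = g x" for n
      using supp by (simp add: G_def)
    then show ?thesis by simp
  next
    case False
    then have "\<forall>\<^sub>F n in sequentially. inverse (real (Suc n)) < x"
      using LIMSEQ_inverse_real_of_nat order_tendstoD(2)[of _ 0 sequentially x] by auto
    moreover have "\<forall>\<^sub>F n in sequentially. x \<le> real n" "\<forall>\<^sub>F n in sequentially. cmod (g x) \<le> real n"
      using filterlim_real_sequentially by (auto simp: filterlim_at_top)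
    ultimately have "\<forall>\<^sub>F n in sequentially. G n x = g x"
      by eventually_elim (auto simp: G_def inverse_eq_divide)
    then show ?thesis by (rule tendsto_eventually)
  qed
  have Tlim: "(\<lambda>n. T (G n) k) \<longlonglongrightarrow> T g k" for k
    unfolding T_def
  proof (rule integral_dominated_convergence[where w = "\<lambda>x. B * cmod (g x)"])
    show "integrable lborel (\<lambda>x. B * cmod (g x))" using g by simp
    show "AE x in lborel. (\<lambda>n. K k x * G n x) \<longlonglongrightarrow> K k x * g x"
      by (intro AE_I2 tendsto_mult Glim tendsto_const)
    show "AE x in lborel. cmod (K k x * G n x) \<le> B * cmod (g x)" for n
      using K_bound Gle B_nonneg by (auto simp: norm_mult intro!: mult_mono)
  qed measurable
  note T_measurable[measurable]
  have "(\<integral>\<^sup>+k. (ennreal (cmod (T g k)))\<^sup>2 \<partial>lborel)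
      = (\<integral>\<^sup>+k. liminf (\<lambda>n. (ennreal (cmod (T (G n) k)))\<^sup>2) \<partial>lborel)"
  proof (intro nn_integral_cong)
    fix k
    have "(\<lambda>n. ennreal ((cmod (T (G n) k))\<^sup>2)) \<longlonglongrightarrow> ennreal ((cmod (T g k))\<^sup>2)"
      by (intro tendsto_ennrealI tendsto_power tendsto_norm Tlim)
    from lim_imp_Liminf[OF sequentially_bot this]
    show "(ennreal (cmod (T g k)))\<^sup>2 = liminf (\<lambda>n. (ennreal (cmod (T (G n) k)))\<^sup>2)"
      by (simp add: ennreal_power)
  qed
  also have "\<dots> \<le> liminf (\<lambda>n. \<integral>\<^sup>+k. (ennreal (cmod (T (G n) k)))\<^sup>2 \<partial>lborel)"
    by (intro nn_integral_liminf) measurable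
  also have "\<dots> \<le> liminf (\<lambda>n. ennreal (C\<^sup>2) * (\<integral>\<^sup>+x. (ennreal (cmod (g x)))\<^sup>2 \<partial>lborel))"
  proof (intro Liminf_mono always_eventually allI)
    fix n
    have "(\<integral>\<^sup>+k. (ennreal (cmod (T (G n) k)))\<^sup>2 \<partial>lborel)
        \<le> ennreal (C\<^sup>2) * (\<integral>\<^sup>+x. (ennreal (cmod (G n x)))\<^sup>2 \<partial>lborel)"
      unfolding T_def
    proof (rule L2_bound_compact[where l = "1 / real (Suc n)" and u = "real n"])
      show "bounded (range (G n))" by (rule boundedI[of _ "real n"]) (auto simp: G_def)
    qed (auto simp: G_def)
    also have "\<dots> \<le> ennreal (C\<^sup>2) * (\<integral>\<^sup>+x. (ennreal (cmod (g x)))\<^sup>2 \<partial>lborel)"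
      using Gle by (intro mult_left_mono nn_integral_mono power_mono ennreal_leI) auto
    finally show "(\<integral>\<^sup>+k. (ennreal (cmod (T (G n) k)))\<^sup>2 \<partial>lborel)
        \<le> ennreal (C\<^sup>2) * (\<integral>\<^sup>+x. (ennreal (cmod (g x)))\<^sup>2 \<partial>lborel)" .
  qed
  also have "\<dots> = ennreal (C\<^sup>2) * (\<integral>\<^sup>+x. (ennreal (cmod (g x)))\<^sup>2 \<partial>lborel)"
    by (simp add: Liminf_const)
  finally show ?thesis .
qed

lemma bounded_on_finite_integrable:
  fixes g :: "real \<Rightarrow> complex"
  assumes [measurable]: "g \<in> borel_measurable borel" "S \<in> sets borel"
    and S: "emeasure lborel S < top" and le: "\<And>x. cmod (g x) \<le> a * indicator S x"
  shows "integrable lborel g"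
proof (rule Bochner_Integration.integrable_bound[of _ "\<lambda>x. a * indicator S x"])
  show "integrable lborel (\<lambda>x. a * indicator S x :: real)"
    using S by simp
  show "AE x in lborel. cmod (g x) \<le> norm (a * indicator S x)"
    using le by (auto intro: order_trans[OF _ abs_ge_self])
qed simp

lemma norm_T_le_measure:
  assumes g: "g \<in> borel_measurable borel" "S \<in> sets borel" "0 \<le> a" "0 \<le> d"
    and S: "emeasure lborel S \<le> ennreal d" and le: "\<And>x. cmod (g x) \<le> a * indicator S x"
  shows "cmod (T g k) \<le> B * (a * d)"
proof -
  have S': "emeasure lborel S < top" using S by (simp add: le_less_trans)
  have int: "integrable lborel g" by (rule bounded_on_finite_integrable[OF g(1,2) S' le])
  have "cmod (T g k) \<le> B * (LINT x|lborel. cmod (g x))" by (rule norm_T_le[OF int])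
  also have "(LINT x|lborel. cmod (g x)) \<le> (LINT x|lborel. a * indicator S x)"
    using int S' g(2) by (intro integral_mono le) auto
  also have "\<dots> = a * measure lborel S" using S' g(2) by simp
  also have "measure lborel S \<le> d" using S g(4) by (simp add: measure_def enn2real_leI)
  finally show ?thesis using B_nonneg g(3) by (simp add: mult_left_mono)
qed

definition cell_max :: "(real \<Rightarrow> complex) \<Rightarrow> real set \<Rightarrow> real \<Rightarrow> nat \<Rightarrow> real \<Rightarrow> ennreal" where
  "cell_max g E m n k = (SUP i. ennreal (cmod (T (\<lambda>x. g x * indicator (cell E (m / 2 ^ n) i) x) k)))"

context
  fixes g :: "real \<Rightarrow> complex" and E :: "real set" and a m :: real
  assumes g_meas [measurable]: "g \<in> borel_measurable borel" and E_meas [measurable]: "E \<in> sets borel"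
    and a: "0 \<le> a" and m: "0 < m" and Em: "emeasure lborel E \<le> ennreal m"
    and g_le: "\<And>x. cmod (g x) \<le> a * indicator E x"
begin

lemma E_finite: "emeasure lborel E < top"
  using Em by (simp add: le_less_trans)

lemma cell_meas [measurable]: "cell E d i \<in> sets borel"
  by (rule cell_sets[OF E_meas E_finite])

lemma level_meas [measurable]: "level E d \<in> measurable borel (count_space UNIV)"
  by (rule level_measurable[OF E_meas E_finite])

lemma g_integrable: "integrable lborel g"
  by (rule bounded_on_finite_integrable[OF g_meas E_meas E_finite g_le])

lemma g_ind_integrable: "S \<in> sets borel \<Longrightarrow> integrable lborel (\<lambda>x. g x * indicator S x)"
  by (rule Bochner_Integration.integrable_bound[OF g_integrable]) (auto simp: indicator_def)

lemma cell_max_measurable: "cell_max g E m n \<in> borel_measurable borel"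
proof -
  have [measurable]: "T (\<lambda>x. g x * indicator (cell E (m / 2 ^ n) i) x) \<in> borel_measurable borel" for i
    by (rule T_measurable) measurable
  show ?thesis unfolding cell_max_def by measurable
qed

lemma cell_max_le: "cell_max g E m n k \<le> ennreal (B * (a * (m / 2 ^ n)))"
  unfolding cell_max_def
proof (rule SUP_least, rule ennreal_leI)
  fix i
  show "cmod (T (\<lambda>x. g x * indicator (cell E (m / 2 ^ n) i) x) k) \<le> B * (a * (m / 2 ^ n))"
  proof (rule norm_T_le_measure[where S = "cell E (m / 2 ^ n) i"])
    show "emeasure lborel (cell E (m / 2 ^ n) i) \<le> ennreal (m / 2 ^ n)"
      using m by (intro emeasure_cell[OF E_meas E_finite]) simp
    show "cmod (g x * indicator (cell E (m / 2 ^ n) i) x) \<le> a * indicator (cell E (m / 2 ^ n) i) x" for x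
      using g_le[of x] a by (cases "x \<in> E") (auto simp: indicator_def)
  qed (use a m in auto)
qed

text \<open>
  The square of the maximum over the cells is at most the sum of the squares, and the \<open>L\<^sup>2\<close> norms of the
  restrictions of \<open>g\<close> to disjoint cells add up to that of \<open>g\<close>.
\<close>
lemma cell_max_L2:
  assumes pos: "\<And>x. x \<in> E \<Longrightarrow> 0 < x"
  shows "(\<integral>\<^sup>+k. (cell_max g E m n k)\<^sup>2 \<partial>lborel) \<le> ennreal (C\<^sup>2 * (a\<^sup>2 * m))"
proof -
  let ?c = "cell E (m / 2 ^ n)"
  let ?g = "\<lambda>i x. g x * indicator (?c i) x"
  have Tm [measurable]: "T (?g i) \<in> borel_measurable borel" for i
    by (rule T_measurable) measurable
  have g0: "g x = 0" if "x \<notin> E" for x using g_le[of x] that by simp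
  have sq: "(cell_max g E m n k)\<^sup>2 \<le> (\<Sum>i. (ennreal (cmod (T (?g i) k)))\<^sup>2)" for k
  proof -
    let ?R = "\<Sum>i. (ennreal (cmod (T (?g i) k)))\<^sup>2"
    have "ennreal (cmod (T (?g i) k)) \<le> epowr ?R (1 / 2)" for i
      using member_le_suminf[of "\<lambda>i. (ennreal (cmod (T (?g i) k)))\<^sup>2" i]
      by (subst epowr_le_iff[symmetric]) (auto simp: epowr_2)
    then have "cell_max g E m n k \<le> epowr ?R (1 / 2)"
      unfolding cell_max_def by (intro SUP_least)
    then show ?thesis by (subst (asm) epowr_le_iff[symmetric]) (auto simp: epowr_2)
  qed
  have "(\<integral>\<^sup>+k. (cell_max g E m n k)\<^sup>2 \<partial>lborel) \<le> (\<integral>\<^sup>+k. (\<Sum>i. (ennreal (cmod (T (?g i) k)))\<^sup>2) \<partial>lborel)"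
    by (intro nn_integral_mono sq)
  also have "\<dots> = (\<Sum>i. \<integral>\<^sup>+k. (ennreal (cmod (T (?g i) k)))\<^sup>2 \<partial>lborel)"
    by (intro nn_integral_suminf) measurable
  also have "\<dots> \<le> (\<Sum>i. ennreal (C\<^sup>2) * (\<integral>\<^sup>+x. (ennreal (cmod (?g i x)))\<^sup>2 \<partial>lborel))"
    using pos g0 by (intro suminf_le L2_bound g_ind_integrable cell_meas) (auto, force)
  also have "\<dots> = ennreal (C\<^sup>2) * (\<Sum>i. \<integral>\<^sup>+x. (ennreal (cmod (?g i x)))\<^sup>2 \<partial>lborel)"
    by (rule ennreal_suminf_cmult)
  also have "(\<Sum>i. \<integral>\<^sup>+x. (ennreal (cmod (?g i x)))\<^sup>2 \<partial>lborel)
      = (\<integral>\<^sup>+x. (\<Sum>i. (ennreal (cmod (?g i x)))\<^sup>2) \<partial>lborel)"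
    by (intro nn_integral_suminf[symmetric]) measurable
  also have "\<dots> \<le> (\<integral>\<^sup>+x. ennreal (a\<^sup>2) * indicator E x \<partial>lborel)"
  proof (rule nn_integral_mono)
    fix x
    have "(\<Sum>i. (ennreal (cmod (?g i x)))\<^sup>2) = (\<Sum>i\<in>{level E (m / 2 ^ n) x}. (ennreal (cmod (?g i x)))\<^sup>2)"
      by (rule suminf_finite) (auto simp: cell_def)
    also have "\<dots> \<le> (ennreal (cmod (g x)))\<^sup>2"
      by (auto simp: indicator_def)
    also have "\<dots> \<le> (ennreal (a * indicator E x))\<^sup>2"
      by (intro power_mono ennreal_leI g_le) auto
    also have "\<dots> = ennreal (a\<^sup>2) * indicator E x"
      using a by (auto simp: indicator_def ennreal_power)
    finally show "(\<Sum>i. (ennreal (cmod (?g i x)))\<^sup>2) \<le> ennreal (a\<^sup>2) * indicator E x" .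
  qed
  also have "\<dots> = ennreal (a\<^sup>2) * emeasure lborel E"
    by (simp add: nn_integral_cmult)
  also have "ennreal (C\<^sup>2) * \<dots> \<le> ennreal (C\<^sup>2) * (ennreal (a\<^sup>2) * ennreal m)"
    by (intro mult_left_mono Em) auto
  also have "\<dots> = ennreal (C\<^sup>2 * (a\<^sup>2 * m))"
    using m by (simp add: ennreal_mult)
  finally show ?thesis by (simp add: mult_left_mono)
qed

text \<open>
  Replace the cutoff at \<open>N\<close> by the union of the cells of depth \<open>n\<close> that precede the one containing \<open>N\<close>,
  which leaves an error within a single cell.  The next depth adds to this union the left half of the
  cell of \<open>N\<close>, if \<open>N\<close> lies in the right half, and nothing otherwise.
\<close>
lemma T_cutoff_le: "ennreal (cmod (T (\<lambda>x. g x * indicator {..N} x) k)) \<le> (\<Sum>n. cell_max g E m n k)"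
proof -
  let ?d = "\<lambda>n. m / 2 ^ n"
  let ?l = "\<lambda>n. level E (?d n) N"
  define S where "S n = T (\<lambda>x. g x * indicator {x. level E (?d n) x < ?l n} x) k" for n
  have g0: "g x = 0" if "x \<notin> E" for x using g_le[of x] that by simp
  have dpos: "0 < ?d n" for n using m by simp
  have half: "?d n / 2 = ?d (Suc n)" for n by simp
  have cell_le: "ennreal (cmod (T (\<lambda>x. g x * indicator (cell E (?d n) i) x) k)) \<le> cell_max g E m n k" for n i
    unfolding cell_max_def by (rule SUP_upper) simp
  have S0: "ennreal (cmod (S 0)) \<le> cell_max g E m 0 k"
  proof -
    \<comment> \<open>There is no more than one full cell of depth 0.\<close>
    have "cumul E N < real (Suc 1) * m"
      using cumul_le[OF E_meas Em, of N] m by simp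
    moreover have "real (?l 0) * m \<le> cumul E N"
      using level_eq_iff[OF dpos, of E 0 N "?l 0"] by simp
    ultimately have "real (?l 0) * m < real 2 * m" by simp
    then have "?l 0 < 2" using m by simp
    then consider "?l 0 = 0" | "?l 0 = 1" by linarith
    then show ?thesis
    proof cases
      case 1
      then show ?thesis by (simp add: S_def T_def)
    next
      case 2
      then have "(\<lambda>x. g x * indicator {x. level E (?d 0) x < ?l 0} x) = (\<lambda>x. g x * indicator (cell E (?d 0) 0) x)"
        using g0 by (auto simp: fun_eq_iff cell_def indicator_def)
      then show ?thesis using cell_le[of 0 0] by (simp add: S_def)
    qed
  qed
  have step: "ennreal (cmod (S (Suc n))) \<le> ennreal (cmod (S n)) + cell_max g E m (Suc n) k" for n
  proof -
    have lev: "level E (?d (Suc n)) x div 2 = level E (?d n) x" for x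
      using level_half[of E "?d n" x] by (simp only: half)
    have half_less: "v < 2 * i \<longleftrightarrow> u < i" if "v div 2 = u" for u v i :: nat
      using that by linarith
    have "?l (Suc n) = 2 * ?l n \<or> ?l (Suc n) = Suc (2 * ?l n)"
      using lev[of N] by linarith
    then show ?thesis
    proof
      assume e: "?l (Suc n) = 2 * ?l n"
      have "{x. level E (?d (Suc n)) x < ?l (Suc n)} = {x. level E (?d n) x < ?l n}"
        unfolding e using half_less[OF lev] by simp
      then show ?thesis by (simp add: S_def)
    next
      assume e: "?l (Suc n) = Suc (2 * ?l n)"
      let ?c = "cell E (?d (Suc n)) (2 * ?l n)"
      have "level E (?d (Suc n)) x < ?l (Suc n) \<longleftrightarrow> level E (?d n) x < ?l n \<or> level E (?d (Suc n)) x = 2 * ?l n" 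
        "\<not> (level E (?d n) x < ?l n \<and> level E (?d (Suc n)) x = 2 * ?l n)" for x
        unfolding e using half_less[OF lev, of x "?l n"] by linarith+
      then have "g x * indicator {x. level E (?d (Suc n)) x < ?l (Suc n)} x
          = g x * indicator {x. level E (?d n) x < ?l n} x + g x * indicator ?c x" for x
        using g0[of x] by (cases "x \<in> E") (auto simp: cell_def indicator_def)
      then have "S (Suc n) = S n + T (\<lambda>x. g x * indicator ?c x) k"
        unfolding S_def by (simp add: T_add[OF g_ind_integrable g_ind_integrable])
      then have "ennreal (cmod (S (Suc n))) \<le> ennreal (cmod (S n)) + ennreal (cmod (T (\<lambda>x. g x * indicator ?c x) k))"
        by (simp add: norm_triangle_ineq ennreal_leI flip: ennreal_plus)
      also have "\<dots> \<le> ennreal (cmod (S n)) + cell_max g E m (Suc n) k"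
        by (intro add_left_mono cell_le)
      finally show ?thesis .
    qed
  qed
  have "ennreal (cmod (S n)) \<le> (\<Sum>i<Suc n. cell_max g E m i k)" for n
  proof (induction n)
    case (Suc n)
    show ?case using order_trans[OF step add_right_mono[OF Suc]] by simp
  qed (use S0 in simp)
  then have Sn: "ennreal (cmod (S n)) \<le> (\<Sum>i. cell_max g E m i k)" for n
    by (rule order_trans) (intro sum_le_suminf, auto)
  show ?thesis
  proof (rule ennreal_le_epsilon)
    fix e :: real assume "0 < e"
    have "(\<lambda>n. B * (a * (m * (1 / 2) ^ n))) \<longlonglongrightarrow> B * (a * (m * 0))"
      by (intro tendsto_intros LIMSEQ_realpow_zero) auto
    then have "\<forall>\<^sub>F n in sequentially. B * (a * (m * (1 / 2) ^ n)) < e"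
      using \<open>0 < e\<close> order_tendstoD(2) by fastforce
    then obtain n where n: "B * (a * ?d n) < e"
      by (auto simp: eventually_sequentially power_one_over)
    \<comment> \<open>The rest of the cutoff lies in the cell of \<open>N\<close>, where the trivial bound for \<open>T\<close> is small.\<close>
    let ?c = "{x \<in> cell E (?d n) (?l n). x \<le> N}"
    have cm: "?c \<in> sets borel" by measurable
    have mono: "cumul E x \<le> cumul E y" if "x \<le> y" for x y
      using mono_cumul[OF E_meas E_finite] that by (auto dest: monoD)
    have lmono: "level E (?d n) x \<le> level E (?d n) y" if "x \<le> y" for x y
      unfolding level_def using mono[OF that] dpos[of n]
      by (intro nat_mono floor_mono divide_right_mono) auto
    have "level E (?d n) x < ?l n \<Longrightarrow> x \<le> N" for x
      using lmono[of N x] by (cases "x \<le> N") auto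
    then have "g x * indicator {..N} x
        = g x * indicator {x. level E (?d n) x < ?l n} x + g x * indicator ?c x" for x
      using g0[of x] lmono[of x N] by (cases "x \<in> E") (auto simp: cell_def indicator_def)
    then have "T (\<lambda>x. g x * indicator {..N} x) k = S n + T (\<lambda>x. g x * indicator ?c x) k"
      unfolding S_def by (simp add: T_add[OF g_ind_integrable g_ind_integrable] cm)
    moreover have "cmod (T (\<lambda>x. g x * indicator ?c x) k) \<le> B * (a * ?d n)"
    proof (rule norm_T_le_measure[where S = "cell E (?d n) (?l n)"])
      show "emeasure lborel (cell E (?d n) (?l n)) \<le> ennreal (?d n)"
        by (intro emeasure_cell[OF E_meas E_finite] dpos)
      show "cmod (g x * indicator ?c x) \<le> a * indicator (cell E (?d n) (?l n)) x" for x
        using g_le[of x] a by (cases "x \<in> E") (auto simp: indicator_def)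
    qed (use a dpos[of n] cm in auto)
    ultimately have "cmod (T (\<lambda>x. g x * indicator {..N} x) k) \<le> cmod (S n) + e"
      using n norm_triangle_ineq[of "S n" "T (\<lambda>x. g x * indicator ?c x) k"] by (simp only:)
    then have "ennreal (cmod (T (\<lambda>x. g x * indicator {..N} x) k)) \<le> ennreal (cmod (S n)) + ennreal e"
      using \<open>0 < e\<close> by (simp add: ennreal_leI flip: ennreal_plus)
    also have "\<dots> \<le> (\<Sum>i. cell_max g E m i k) + ennreal e"
      by (intro add_right_mono Sn)
    finally show "ennreal (cmod (T (\<lambda>x. g x * indicator {..N} x) k)) \<le> (\<Sum>i. cell_max g E m i k) + ennreal e" .
  qed
qed

end

end

section \<open>Summation over the pieces of a function\<close>

lemma young_two_terms:
  fixes x y :: real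
  assumes "0 \<le> x" "0 \<le> y" "2 < q"
  shows "x powr (q - 2) * y\<^sup>2 \<le> x powr q + y powr q"
proof -
  have eq: "z powr (q - 2) * z\<^sup>2 = z powr q" if "0 \<le> z" for z :: real
  proof -
    have "z powr (q - 2) * z\<^sup>2 = z powr (q - 2) * z powr 2" using that by (cases "z = 0") auto
    then show ?thesis by (simp add: powr_add[symmetric])
  qed
  show ?thesis
  proof (cases "x \<le> y")
    case True
    then have "x powr (q - 2) * y\<^sup>2 \<le> y powr (q - 2) * y\<^sup>2"
      using assms by (intro mult_right_mono powr_mono2) auto
    then show ?thesis using eq[OF assms(2)] by (simp add: add_increasing)
  next
    case False
    then have "x powr (q - 2) * y\<^sup>2 \<le> x powr (q - 2) * x\<^sup>2"
      using assms by (intro mult_left_mono power_mono) auto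
    then show ?thesis using eq[OF assms(1)] by (simp add: add_increasing2)
  qed
qed

text \<open>
  The left-hand side is homogeneous of degree \<open>q\<close> in the normalized heights \<open>a 2^(i(q-1)/q)\<close> and
  \<open>b 2^((i+d)(q-1)/q)\<close>; the gain in \<open>d\<close> is what remains of the powers of 2 after normalizing.
\<close>
lemma weighted_young:
  fixes a b i q :: real
  assumes "0 \<le> a" "0 \<le> b" "2 < q"
  shows "(a * 2 powr i) powr (q - 2) * (b\<^sup>2 * 2 powr (i + d))
    \<le> 2 powr (- ((q - 2) / q) * d) * (a powr q * 2 powr (i * (q - 1)) + b powr q * 2 powr ((i + d) * (q - 1)))"
proof -
  define s where "s = (q - 1) / q"
  define x where "x = a * 2 powr (i * s)"
  define y where "y = b * 2 powr ((i + d) * s)"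
  have xy: "0 \<le> x" "0 \<le> y" using assms by (auto simp: x_def y_def)
  have s: "s * q = q - 1" using assms by (simp add: s_def)
  have y2: "y\<^sup>2 = b\<^sup>2 * 2 powr (2 * ((i + d) * s))"
    by (simp add: y_def power_mult_distrib powr_power)
  have e: "i * (q - 2) + (i + d) = - ((q - 2) / q) * d + (i * s * (q - 2) + 2 * ((i + d) * s))"
    using assms(3) by (simp add: s_def field_simps)
  have "(a * 2 powr i) powr (q - 2) * (b\<^sup>2 * 2 powr (i + d))
      = a powr (q - 2) * b\<^sup>2 * 2 powr (i * (q - 2) + (i + d))"
    using assms by (simp add: powr_mult powr_powr powr_add)
  also have "\<dots> = 2 powr (- ((q - 2) / q) * d) * (x powr (q - 2) * y\<^sup>2)"
    unfolding e powr_add y2 using assms by (simp add: x_def powr_mult powr_powr)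
  also have "\<dots> \<le> 2 powr (- ((q - 2) / q) * d) * (x powr q + y powr q)"
    using young_two_terms[OF xy assms(3)] by (intro mult_left_mono) auto
  also have "x powr q = a powr q * 2 powr (i * (q - 1))"
    using assms s by (simp add: x_def powr_mult powr_powr mult.assoc)
  also have "y powr q = b powr q * 2 powr ((i + d) * (q - 1))"
    using assms s by (simp add: y_def powr_mult powr_powr mult.assoc)
  finally show ?thesis .
qed

lemma nn_integral_count_space_shift:
  fixes f :: "int \<Rightarrow> ennreal"
  shows "(\<integral>\<^sup>+i. f (i + c) \<partial>count_space UNIV) = (\<integral>\<^sup>+i. f i \<partial>count_space UNIV)"
  by (rule nn_integral_bij_count_space) (rule bij_plus_right)

text \<open>
  The first two factors are the losses in the sums over the depths and over the pieces, with weights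
  \<open>2^(n(q-2)/2)\<close> and \<open>2^(d(q-2)/(2q))\<close>; each weight is the square root of
  the gain that it competes with, and the last two geometric sums are what is left of the gains.
\<close>
definition (in L2_kernel) majorant_const :: "real \<Rightarrow> real" where
  "majorant_const q =
     geom_sum ((q - 2) / 2 / q) powr q * (2 * geom_sum ((q - 2) / q / 2 / q)) powr q *
     (B powr (q - 2) * C\<^sup>2 * geom_sum ((q - 2) / 2) * geom_sum ((q - 2) / q / 2) * 2)"

text \<open>
  A function cut into pieces of height \<open>a j\<close> on disjoint sets of measure at most \<open>2^j\<close>.  The sequence
  \<open>a\<close> is arbitrary; in the application it is a sequence of values of the rearrangement.
\<close>
locale dyadic_decomposition = L2_kernel +
  fixes f :: "real \<Rightarrow> complex" and E :: "int \<Rightarrow> real set" and a :: "int \<Rightarrow> real" and q :: real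
  assumes f_meas [measurable]: "f \<in> borel_measurable borel"
    and E_meas [measurable]: "\<And>j. E j \<in> sets borel"
    and E_pos: "\<And>j x. x \<in> E j \<Longrightarrow> 0 < x"
    and E_disjoint: "\<And>i j x. x \<in> E i \<Longrightarrow> x \<in> E j \<Longrightarrow> i = j"
    and E_cover: "AE x in lborel. f x \<noteq> 0 \<longrightarrow> (\<exists>j. x \<in> E j)"
    and E_le: "\<And>j. emeasure lborel (E j) \<le> ennreal (2 powr real_of_int j)"
    and a_nonneg: "\<And>j. 0 \<le> a j"
    and f_le: "\<And>j x. x \<in> E j \<Longrightarrow> cmod (f x) \<le> a j"
    and q: "2 < q"
begin

definition piece :: "int \<Rightarrow> real \<Rightarrow> complex" where
  "piece j x = f x * indicator (E j) x"

lemma piece_meas [measurable]: "piece j \<in> borel_measurable borel"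
  unfolding piece_def[abs_def] by measurable

lemma piece_le: "cmod (piece j x) \<le> a j * indicator (E j) x"
  using f_le[of x j] by (auto simp: piece_def indicator_def)

definition majorant :: "real \<Rightarrow> ennreal" where
  "majorant k = (\<integral>\<^sup>+j. (\<Sum>n. cell_max (piece j) (E j) (2 powr real_of_int j) n k) \<partial>count_space UNIV)"

abbreviation "h j n \<equiv> cell_max (piece j) (E j) (2 powr real_of_int j) n"

lemma h_measurable [measurable]: "h j n \<in> borel_measurable borel"
  by (rule cell_max_measurable[OF piece_meas E_meas a_nonneg _ E_le piece_le]) simp

lemma h_le: "h j n k \<le> ennreal (B * (a j * (2 powr real_of_int j / 2 ^ n)))"
  by (rule cell_max_le[OF piece_meas E_meas a_nonneg _ E_le piece_le]) simp

lemma h_L2: "(\<integral>\<^sup>+k. (h j n k)\<^sup>2 \<partial>lborel) \<le> ennreal (C\<^sup>2 * ((a j)\<^sup>2 * 2 powr real_of_int j))"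
  by (rule cell_max_L2[OF piece_meas E_meas a_nonneg _ E_le piece_le E_pos]) simp

lemma majorant_measurable: "majorant \<in> borel_measurable borel"
  unfolding majorant_def nn_integral_count_space_int by measurable

lemma T_cutoff_sum_le:
  "(\<integral>\<^sup>+j. ennreal (cmod (T (\<lambda>x. piece j x * indicator {..N} x) k)) \<partial>count_space UNIV) \<le> majorant k"
  unfolding majorant_def
  by (intro nn_integral_mono T_cutoff_le[OF piece_meas E_meas a_nonneg _ E_le piece_le]) simp

text \<open>
  The uniform bound is used for the piece on the smaller set and the \<open>L\<^sup>2\<close> bound for the other one.
\<close>
lemma pair_integral_le:
  fixes d n :: nat
  defines "w \<equiv> \<lambda>i. a i powr q * 2 powr (real_of_int i * (q - 1))"
  shows "(\<integral>\<^sup>+k. epowr (h i n k) (q - 2) * (h (i + int d) n k)\<^sup>2 \<partial>lborel)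
    \<le> ennreal (B powr (q - 2) * C\<^sup>2 * 2 powr (- (q - 2) * real n) * 2 powr (- ((q - 2) / q) * real d))
      * (ennreal (w i) + ennreal (w (i + int d)))"
proof -
  let ?j = "i + int d"
  have "(\<integral>\<^sup>+k. epowr (h i n k) (q - 2) * (h ?j n k)\<^sup>2 \<partial>lborel)
      \<le> (\<integral>\<^sup>+k. ennreal ((B * (a i * (2 powr real_of_int i / 2 ^ n))) powr (q - 2)) * (h ?j n k)\<^sup>2 \<partial>lborel)"
  proof (intro nn_integral_mono mult_right_mono)
    fix k
    have "epowr (h i n k) (q - 2) \<le> epowr (ennreal (B * (a i * (2 powr real_of_int i / 2 ^ n)))) (q - 2)"
      using q by (intro epowr_mono h_le) auto
    then show "epowr (h i n k) (q - 2) \<le> ennreal ((B * (a i * (2 powr real_of_int i / 2 ^ n))) powr (q - 2))"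
      using B_nonneg a_nonneg by (simp add: epowr_ennreal)
  qed simp
  also have "\<dots> = ennreal ((B * (a i * (2 powr real_of_int i / 2 ^ n))) powr (q - 2)) * (\<integral>\<^sup>+k. (h ?j n k)\<^sup>2 \<partial>lborel)"
    by (intro nn_integral_cmult) measurable
  also have "\<dots> \<le> ennreal ((B * (a i * (2 powr real_of_int i / 2 ^ n))) powr (q - 2)) * ennreal (C\<^sup>2 * ((a ?j)\<^sup>2 * 2 powr real_of_int ?j))"
    by (intro mult_left_mono h_L2) simp
  also have "\<dots> = ennreal ((B * (a i * (2 powr real_of_int i / 2 ^ n))) powr (q - 2) * (C\<^sup>2 * ((a ?j)\<^sup>2 * 2 powr real_of_int ?j)))"
    by (rule ennreal_mult[symmetric]) auto
  also have "(B * (a i * (2 powr real_of_int i / 2 ^ n))) powr (q - 2)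
      = B powr (q - 2) * 2 powr (- (q - 2) * real n) * (a i * 2 powr real_of_int i) powr (q - 2)"
  proof -
    have "(2::real) ^ n = 2 powr real n" by (simp add: powr_realpow)
    moreover have "2 powr (- (q - 2) * real n) = 1 / 2 powr (real n * (q - 2))"
      by (metis minus_mult_left mult.commute powr_minus_divide)
    ultimately show ?thesis
      using B_nonneg a_nonneg[of i] by (simp add: powr_mult powr_divide powr_powr)
  qed
  also have "\<dots> * (C\<^sup>2 * ((a ?j)\<^sup>2 * 2 powr real_of_int ?j))
      = B powr (q - 2) * C\<^sup>2 * 2 powr (- (q - 2) * real n)
        * ((a i * 2 powr real_of_int i) powr (q - 2) * ((a ?j)\<^sup>2 * 2 powr (real_of_int i + real d)))"
    by simp
  also have "\<dots> \<le> B powr (q - 2) * C\<^sup>2 * 2 powr (- (q - 2) * real n)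
        * (2 powr (- ((q - 2) / q) * real d) * (w i + w ?j))"
    using weighted_young[OF a_nonneg a_nonneg q, of i "real_of_int i" ?j "real d"]
    by (intro mult_left_mono) (auto simp: w_def)
  finally show ?thesis
    by (simp add: w_def ennreal_mult ennreal_plus mult.assoc ennreal_leI)
qed

lemma majorant_bound:
  "(\<integral>\<^sup>+k. epowr (majorant k) q \<partial>lborel)
    \<le> ennreal (majorant_const q)
      * (\<integral>\<^sup>+j. ennreal (a j powr q * 2 powr (real_of_int j * (q - 1))) \<partial>count_space UNIV)"
proof -
  define w where "w i = ennreal (a i powr q * 2 powr (real_of_int i * (q - 1)))" for i
  define W where "W = (\<integral>\<^sup>+j. w j \<partial>count_space UNIV)"
  \<comment> \<open>The depth gains \<open>2^(-n(q-2))\<close> and the distance of a pair gains \<open>2^(-d(q-2)/q)\<close>; half of each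
    exponent is spent on the weights.\<close>
  define e1 where "e1 = (q - 2) / 2"
  define e2 where "e2 = (q - 2) / q / 2"
  have e: "0 < e1" "0 < e2" using q by (auto simp: e1_def e2_def)
  define c1 where "c1 = geom_sum (e1 / q) powr q"
  define c2 where "c2 = (2 * geom_sum (e2 / q)) powr q"
  define c3 where "c3 = B powr (q - 2) * C\<^sup>2"
  let ?P = "\<lambda>n d i k. epowr (h i n k) (q - 2) * (h (i + int d) n k)\<^sup>2"
  have pointwise: "epowr (majorant k) q \<le> ennreal c1 * (\<Sum>n. ennreal (2 powr (e1 * real n)) * (ennreal c2 *
      (\<Sum>d. \<integral>\<^sup>+i. ennreal (2 powr (e2 * real d)) * ?P n d i k \<partial>count_space UNIV)))" for k
  proof -
    have "majorant k = (\<Sum>n. \<integral>\<^sup>+j. h j n k \<partial>count_space UNIV)"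
      unfolding majorant_def by (rule nn_integral_suminf) simp
    then have "epowr (majorant k) q \<le> ennreal c1 * (\<Sum>n. ennreal (2 powr (e1 * real n)) * epowr (\<integral>\<^sup>+j. h j n k \<partial>count_space UNIV) q)"
      unfolding c1_def using q e by (simp only:) (intro epowr_suminf_le, auto)
    also have "\<dots> \<le> ennreal c1 * (\<Sum>n. ennreal (2 powr (e1 * real n)) * (ennreal c2 *
      (\<Sum>d. \<integral>\<^sup>+i. ennreal (2 powr (e2 * real d)) * ?P n d i k \<partial>count_space UNIV)))"
      unfolding c2_def using q e by (intro mult_left_mono suminf_le epowr_sum_le_pairs) auto
    finally show ?thesis .
  qed
  have inner: "(\<integral>\<^sup>+k. (\<integral>\<^sup>+i. ennreal (2 powr (e2 * real d)) * ?P n d i k \<partial>count_space UNIV) \<partial>lborel)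
      \<le> ennreal (c3 * 2) * W * ennreal (2 powr (- (q - 2) * real n)) * ennreal (2 powr (- e2 * real d))" for n d
  proof -
    have "(\<integral>\<^sup>+k. (\<integral>\<^sup>+i. ennreal (2 powr (e2 * real d)) * ?P n d i k \<partial>count_space UNIV) \<partial>lborel)
        = (\<integral>\<^sup>+i. (\<integral>\<^sup>+k. ennreal (2 powr (e2 * real d)) * ?P n d i k \<partial>lborel) \<partial>count_space UNIV)"
      unfolding nn_integral_count_space_int by (rule nn_integral_suminf) measurable
    also have "\<dots> = (\<integral>\<^sup>+i. ennreal (2 powr (e2 * real d)) * (\<integral>\<^sup>+k. ?P n d i k \<partial>lborel) \<partial>count_space UNIV)"
      by (intro nn_integral_cong nn_integral_cmult) measurable
    also have "\<dots> \<le> (\<integral>\<^sup>+i. ennreal (2 powr (e2 * real d)) *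
        (ennreal (c3 * 2 powr (- (q - 2) * real n) * 2 powr (- ((q - 2) / q) * real d)) * (w i + w (i + int d))) \<partial>count_space UNIV)"
      unfolding w_def c3_def by (intro nn_integral_mono mult_left_mono pair_integral_le) simp
    also have "\<dots> = (ennreal (2 powr (e2 * real d)) *
        ennreal (c3 * 2 powr (- (q - 2) * real n) * 2 powr (- ((q - 2) / q) * real d))) * (W + W)"
      by (simp add: mult.assoc[symmetric] nn_integral_cmult nn_integral_add nn_integral_count_space_shift W_def)
    also have "W + W = ennreal 2 * W" by (simp add: mult_2)
    also have "ennreal (2 powr (e2 * real d)) *
        ennreal (c3 * 2 powr (- (q - 2) * real n) * 2 powr (- ((q - 2) / q) * real d)) * (ennreal 2 * W)
       = ennreal (2 powr (e2 * real d) * (c3 * 2 powr (- (q - 2) * real n) * 2 powr (- ((q - 2) / q) * real d)) * 2) * W"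
      using B_nonneg by (simp add: c3_def ennreal_mult mult.assoc)
    also have "2 powr (e2 * real d) * (c3 * 2 powr (- (q - 2) * real n) * 2 powr (- ((q - 2) / q) * real d)) * 2
        = c3 * 2 * 2 powr (- (q - 2) * real n) * (2 powr (e2 * real d) * 2 powr (- ((q - 2) / q) * real d))"
      by simp
    also have "2 powr (e2 * real d) * 2 powr (- ((q - 2) / q) * real d) = 2 powr (- e2 * real d)"
      unfolding powr_add[symmetric] by (rule arg_cong[where f = "\<lambda>x. 2 powr x"]) (simp add: e2_def field_simps)
    finally show ?thesis
      using B_nonneg by (simp add: c3_def ennreal_mult mult_ac)
  qed
  have "(\<integral>\<^sup>+k. epowr (majorant k) q \<partial>lborel)
      \<le> (\<integral>\<^sup>+k. ennreal c1 * (\<Sum>n. ennreal (2 powr (e1 * real n)) * (ennreal c2 *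
      (\<Sum>d. \<integral>\<^sup>+i. ennreal (2 powr (e2 * real d)) * ?P n d i k \<partial>count_space UNIV))) \<partial>lborel)"
    by (intro nn_integral_mono pointwise)
  also have "\<dots> = ennreal c1 * (\<Sum>n. ennreal (2 powr (e1 * real n)) * (ennreal c2 *
      (\<Sum>d. (\<integral>\<^sup>+k. (\<integral>\<^sup>+i. ennreal (2 powr (e2 * real d)) * ?P n d i k \<partial>count_space UNIV) \<partial>lborel))))"
  proof -
    define F where "F n d k = (\<integral>\<^sup>+i. ennreal (2 powr (e2 * real d)) * ?P n d i k \<partial>count_space UNIV)" for n d k
    have [measurable]: "F n d \<in> borel_measurable borel" for n d
      unfolding F_def nn_integral_count_space_int by measurable
    have "(\<integral>\<^sup>+k. ennreal c1 * (\<Sum>n. ennreal (2 powr (e1 * real n)) * (ennreal c2 * (\<Sum>d. F n d k))) \<partial>lborel)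
      = ennreal c1 * (\<Sum>n. ennreal (2 powr (e1 * real n)) * (ennreal c2 * (\<Sum>d. \<integral>\<^sup>+k. F n d k \<partial>lborel)))"
      by (simp add: nn_integral_cmult nn_integral_suminf)
    then show ?thesis by (simp only: F_def)
  qed
  also have "\<dots> \<le> ennreal c1 * (\<Sum>n. ennreal (2 powr (e1 * real n)) * (ennreal c2 *
      (\<Sum>d. ennreal (c3 * 2) * W * ennreal (2 powr (- (q - 2) * real n)) * ennreal (2 powr (- e2 * real d)))))"
    by (intro mult_left_mono suminf_le inner) auto
  also have "\<dots> = ennreal c1 * (\<Sum>n. ennreal (2 powr (e1 * real n)) * (ennreal c2 *
      (ennreal (c3 * 2) * W * ennreal (2 powr (- (q - 2) * real n)) * ennreal (geom_sum e2))))"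
    using e by (simp only: ennreal_suminf_cmult suminf_geom)
  also have "\<dots> = ennreal c1 * (\<Sum>n. ennreal c2 * ennreal (c3 * 2) * W * ennreal (geom_sum e2) * ennreal (2 powr (- e1 * real n)))"
  proof -
    have "ennreal (2 powr (- e1 * real n)) = ennreal (2 powr (e1 * real n)) * ennreal (2 powr (- (q - 2) * real n))" for n
      unfolding ennreal_mult[OF powr_ge_zero powr_ge_zero, symmetric] powr_add[symmetric]
      by (rule arg_cong[where f = "\<lambda>x. ennreal (2 powr x)"]) (simp add: e1_def field_simps)
    then show ?thesis by (simp only: mult_ac)
  qed
  also have "\<dots> = ennreal c1 * (ennreal c2 * ennreal (c3 * 2) * W * ennreal (geom_sum e2) * ennreal (geom_sum e1))"
    using e by (simp only: ennreal_suminf_cmult suminf_geom)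
  also have "\<dots> = ennreal (c1 * c2 * (c3 * geom_sum e1 * geom_sum e2 * 2)) * W"
    using geom_sum_nonneg[OF e(1)] geom_sum_nonneg[OF e(2)]
    by (simp add: c1_def c2_def c3_def ennreal_mult mult_ac)
  finally show ?thesis
    by (simp add: W_def w_def c1_def c2_def c3_def e1_def e2_def majorant_const_def)
qed

end

section \<open>Partial integrals of the whole function\<close>

context dyadic_decomposition
begin

definition weight_sum :: ennreal where
  "weight_sum = (\<integral>\<^sup>+j. ennreal (a j powr q * 2 powr (real_of_int j * (q - 1))) \<partial>count_space UNIV)"

lemma piece_integrable: "integrable lborel (piece j)"
  by (rule bounded_on_finite_integrable[OF piece_meas E_meas _ piece_le]) 
    (simp add: le_less_trans[OF E_le])

lemma cutoff_integrable:
  "integrable lborel g \<Longrightarrow> integrable lborel (\<lambda>x. g x * indicator {..N} x)"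
  for g :: "real \<Rightarrow> complex"
  by (rule Bochner_Integration.integrable_bound[of _ g]) (auto simp: indicator_def)

text \<open>
  A single term of the convergent series bounds its height.
\<close>
lemma size_decay:
  assumes "weight_sum < top"
  obtains D where "0 \<le> D" "\<And>j. a j \<le> D * 2 powr (- (q - 1) / q * real_of_int j)"
proof
  define D where "D = enn2real weight_sum powr (1 / q)"
  show "0 \<le> D" by (simp add: D_def)
  fix j
  have "ennreal (a j powr q * 2 powr (real_of_int j * (q - 1))) \<le> weight_sum"
    unfolding weight_sum_def by (rule count_space_member_le)
  then have "a j powr q * 2 powr (real_of_int j * (q - 1)) \<le> enn2real weight_sum"
    using assms enn2real_mono by fastforce
  then have "(a j powr q * 2 powr (real_of_int j * (q - 1))) powr (1 / q) \<le> D"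
    unfolding D_def using q by (intro powr_mono2) auto
  then have "a j * 2 powr (real_of_int j * (q - 1) / q) \<le> D"
    using q a_nonneg[of j] by (simp add: powr_mult powr_powr)
  then have le: "a j * 2 powr (real_of_int j * (q - 1) / q) * 2 powr (- (q - 1) / q * real_of_int j)
      \<le> D * 2 powr (- (q - 1) / q * real_of_int j)"
    by (rule mult_right_mono) simp
  have one: "2 powr (real_of_int j * (q - 1) / q) * 2 powr (- (q - 1) / q * real_of_int j) = (1::real)"
    by (simp add: powr_add[symmetric] add_divide_distrib[symmetric] algebra_simps)
  show "a j \<le> D * 2 powr (- (q - 1) / q * real_of_int j)"
    using le unfolding mult.assoc one by simp
qed

text \<open>
  The pieces with \<open>j < 0\<close> have integrable sum, because their \<open>L\<^sup>1\<close> norms \<open>a\<^sub>j 2^j\<close> decay geometrically as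
  \<open>j \<rightarrow> -\<infinity>\<close>; the others are uniformly bounded, hence integrable up to \<open>N\<close>.
\<close>
lemma locally_integrable:
  assumes "weight_sum < top"
  shows "integrable lborel (\<lambda>x. f x * indicator {..N} x)"
proof (rule integrableI_bounded)
  obtain D where D: "0 \<le> D" "\<And>j. a j \<le> D * 2 powr (- (q - 1) / q * real_of_int j)"
    using size_decay[OF assms] by blast
  have neg: "(\<integral>\<^sup>+x. ennreal (cmod (piece (- int n) x)) \<partial>lborel) \<le> ennreal D * ennreal (2 powr (- (1 / q) * real n))" for n
  proof -
    have "(\<integral>\<^sup>+x. ennreal (cmod (piece (- int n) x)) \<partial>lborel)
        \<le> (\<integral>\<^sup>+x. ennreal (a (- int n)) * indicator (E (- int n)) x \<partial>lborel)"
    proof (rule nn_integral_mono)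
      fix x
      show "ennreal (cmod (piece (- int n) x)) \<le> ennreal (a (- int n)) * indicator (E (- int n)) x"
        using piece_le[of "- int n" x] by (cases "x \<in> E (- int n)") (auto intro: ennreal_leI)
    qed
    also have "\<dots> = ennreal (a (- int n)) * emeasure lborel (E (- int n))"
      by (simp add: nn_integral_cmult)
    also have "\<dots> \<le> ennreal (D * 2 powr (- (q - 1) / q * real_of_int (- int n))) * ennreal (2 powr real_of_int (- int n))"
      by (intro mult_mono E_le ennreal_leI D) auto
    also have "\<dots> = ennreal D * ennreal (2 powr (- (q - 1) / q * real_of_int (- int n)) * 2 powr real_of_int (- int n))"
      using D(1) by (simp add: ennreal_mult mult.assoc)
    also have "2 powr (- (q - 1) / q * real_of_int (- int n)) * 2 powr real_of_int (- int n) = 2 powr (- (1 / q) * real n)"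
      unfolding powr_add[symmetric] using q by (intro arg_cong[where f = "\<lambda>x. 2 powr x"]) (simp add: field_simps)
    finally show ?thesis .
  qed
  have pw: "AE x in lborel. ennreal (cmod (f x * indicator {..N} x))
      \<le> ennreal D * indicator {0..N} x + (\<Sum>n. ennreal (cmod (piece (- int n) x)))"
    using E_cover
  proof eventually_elim
    case (elim x)
    show ?case
    proof (cases "f x = 0 \<or> N < x")
      case False
      then obtain j where j: "x \<in> E j" using elim by blast
      have x: "0 < x" "x \<le> N" using E_pos[OF j] False by auto
      show ?thesis
      proof (cases "0 \<le> j")
        case True
        have "cmod (f x) \<le> D * 2 powr (- (q - 1) / q * real_of_int j)"
          using f_le[OF j] D(2)[of j] by linarith
        also have "\<dots> \<le> D * 1"
        proof (rule mult_left_mono)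
          have "- (q - 1) / q * real_of_int j \<le> 0"
            using q True by (intro mult_nonpos_nonneg divide_nonpos_pos) auto
          then show "2 powr (- (q - 1) / q * real_of_int j) \<le> (1::real)"
            using powr_mono[of "- (q - 1) / q * real_of_int j" 0 2] by simp
        qed (rule D(1))
        finally have "ennreal (cmod (f x)) \<le> ennreal D" by (simp add: ennreal_leI)
        then show ?thesis using x by (simp add: add_increasing2)
      next
        case False
        have "ennreal (cmod (f x)) = ennreal (cmod (piece (- int (nat (- j))) x))"
          using False j by (simp add: piece_def)
        also have "\<dots> \<le> (\<Sum>n. ennreal (cmod (piece (- int n) x)))"
          by (rule member_le_suminf)
        also have "\<dots> \<le> ennreal D * indicator {0..N} x + (\<Sum>n. ennreal (cmod (piece (- int n) x)))"
          by (rule add_increasing) simp_all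
        finally show ?thesis using x by simp
      qed
    qed auto
  qed
  have "(\<integral>\<^sup>+x. ennreal (cmod (f x * indicator {..N} x)) \<partial>lborel)
      \<le> (\<integral>\<^sup>+x. ennreal D * indicator {0..N} x + (\<Sum>n. ennreal (cmod (piece (- int n) x))) \<partial>lborel)"
    by (rule nn_integral_mono_AE[OF pw])
  also have "\<dots> = ennreal D * emeasure lborel {0..N} + (\<Sum>n. \<integral>\<^sup>+x. ennreal (cmod (piece (- int n) x)) \<partial>lborel)"
    by (simp add: nn_integral_add nn_integral_cmult nn_integral_suminf)
  also have "\<dots> \<le> ennreal D * emeasure lborel {0..N} + (\<Sum>n. ennreal D * ennreal (2 powr (- (1 / q) * real n)))"
    by (intro add_left_mono suminf_le neg) auto
  also have "\<dots> = ennreal D * emeasure lborel {0..N} + ennreal D * ennreal (geom_sum (1 / q))"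
    using q by (simp only: ennreal_suminf_cmult) (subst suminf_geom, auto)
  also have "\<dots> < top"
    by (simp add: ennreal_mult_less_top emeasure_lborel_Icc_eq)
  finally show "(\<integral>\<^sup>+x. ennreal (cmod (f x * indicator {..N} x)) \<partial>lborel) < \<infinity>" by simp
qed simp

lemma T_cutoff_sums:
  assumes "weight_sum < top"
  shows "(\<lambda>n. T (\<lambda>x. piece (int_decode n) x * indicator {..N} x) k) sums T (\<lambda>x. f x * indicator {..N} x) k"
proof -
  let ?f = "\<lambda>x. f x * indicator {..N} x"
  let ?p = "\<lambda>n x. piece (int_decode n) x * indicator {..N} x"
  let ?F = "\<lambda>n x. K k x * ?p n x"
  have fint: "integrable lborel ?f" by (rule locally_integrable[OF assms])
  have pint: "integrable lborel (?p n)" for n by (rule cutoff_integrable[OF piece_integrable])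
  have sums: "(\<lambda>n. c * ?p n x) sums (c * ?f x) \<and> (\<lambda>n. cmod (c * ?p n x)) sums cmod (c * ?f x)"
    if x: "f x \<noteq> 0 \<longrightarrow> (\<exists>j. x \<in> E j)" for x c
  proof (cases "f x = 0")
    case False
    then obtain j where j: "x \<in> E j" using x by blast
    \<comment> \<open>At a point of \<open>E j\<close> the series over the pieces has a single nonzero term.\<close>
    define m where "m = int_encode j"
    have "piece (int_decode n) x = (if n = m then f x else 0)" for n
    proof (cases "n = m")
      case True
      then show ?thesis using j by (simp add: piece_def m_def)
    next
      case False
      then have "j \<noteq> int_decode n" unfolding m_def by (metis int_decode_inverse)
      then have "x \<notin> E (int_decode n)" using j E_disjoint by blast
      with False show ?thesis by (simp add: piece_def)
    qed
    then have "(\<lambda>n. c * ?p n x) = (\<lambda>n. if n = m then c * ?f x else 0)"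
      "(\<lambda>n. cmod (c * ?p n x)) = (\<lambda>n. if n = m then cmod (c * ?f x) else 0)" by auto
    then show ?thesis
      using sums_single[of m "\<lambda>_. c * ?f x"] sums_single[of m "\<lambda>_. cmod (c * ?f x)"] by simp
  qed (simp add: piece_def)
  have "(\<lambda>n. integral\<^sup>L lborel (?F n)) sums (\<integral>x. (\<Sum>n. ?F n x) \<partial>lborel)"
  proof (rule sums_integral)
    show "integrable lborel (?F n)" for n by (rule T_integrable[OF pint])
    show "AE x in lborel. summable (\<lambda>n. norm (?F n x))"
      using E_cover by eventually_elim (use sums sums_summable in blast)
    have "(\<Sum>n. ennreal (\<integral>x. norm (?F n x) \<partial>lborel)) = (\<Sum>n. \<integral>\<^sup>+x. ennreal (norm (?F n x)) \<partial>lborel)"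
      using T_integrable[OF pint, of k] by (intro suminf_cong nn_integral_eq_integral[symmetric]) (auto intro!: integrable_norm)
    also have "\<dots> = (\<integral>\<^sup>+x. (\<Sum>n. ennreal (norm (?F n x))) \<partial>lborel)"
      by (intro nn_integral_suminf[symmetric]) measurable
    also have "\<dots> = (\<integral>\<^sup>+x. ennreal (norm (K k x * ?f x)) \<partial>lborel)"
      using E_cover by (intro nn_integral_cong_AE, eventually_elim) (intro suminf_ennreal_eq norm_ge_zero sums[THEN conjunct2])
    also have "\<dots> < top"
      using T_integrable[OF fint, of k] by (simp add: integrable_iff_bounded)
    finally show "summable (\<lambda>n. \<integral>x. norm (?F n x) \<partial>lborel)"
      by (intro summable_suminf_not_top) auto
  qed
  also have "(\<integral>x. (\<Sum>n. ?F n x) \<partial>lborel) = (\<integral>x. K k x * ?f x \<partial>lborel)"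
  proof (rule integral_cong_AE)
    show "AE x in lborel. (\<Sum>n. ?F n x) = K k x * ?f x"
      using E_cover
    proof eventually_elim
      case (elim x)
      show ?case using sums[OF elim, of "K k x"] by (simp only: sums_iff)
    qed
  qed measurable
  finally show ?thesis by (simp add: T_def)
qed

lemma T_cutoff_le_majorant:
  assumes "weight_sum < top"
  shows "ennreal (cmod (T (\<lambda>x. f x * indicator {..N} x) k)) \<le> majorant k"
proof (cases "majorant k = top")
  case False
  let ?c = "\<lambda>n. T (\<lambda>x. piece (int_decode n) x * indicator {..N} x) k"
  have le: "(\<Sum>n. ennreal (cmod (?c n))) \<le> majorant k"
    using T_cutoff_sum_le[of N k] by (simp add: nn_integral_count_space_int)
  then have "(\<Sum>n. ennreal (cmod (?c n))) \<noteq> top" using False by (auto simp: top_unique)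
  then have summable: "summable (\<lambda>n. cmod (?c n))" by (intro summable_suminf_not_top) auto
  have "cmod (T (\<lambda>x. f x * indicator {..N} x) k) \<le> (\<Sum>n. cmod (?c n))"
    using summable_norm[OF summable] sums_unique[OF T_cutoff_sums[OF assms, of N k]] by simp
  then have "ennreal (cmod (T (\<lambda>x. f x * indicator {..N} x) k)) \<le> (\<Sum>n. ennreal (cmod (?c n)))"
    using summable by (subst suminf_ennreal2) (auto intro: ennreal_leI)
  with le show ?thesis by simp
qed simp

lemma T_cutoff_converges:
  assumes "weight_sum < top" "majorant k < top"
  shows "\<exists>L. ((\<lambda>N. T (\<lambda>x. f x * indicator {..N} x) k) \<longlongrightarrow> L) at_top"
proof -
  let ?c = "\<lambda>n N. T (\<lambda>x. piece (int_decode n) x * indicator {..N} x) k"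
  define M where "M n = (\<Sum>i. h (int_decode n) i k)" for n
  have Msum: "(\<Sum>n. M n) < top"
    using assms(2) by (simp add: majorant_def nn_integral_count_space_int M_def)
  then have Mfin: "M n < top" for n
    using member_le_suminf[of M n] le_less_trans by blast
  have "((\<lambda>N. \<Sum>n. ?c n N) \<longlongrightarrow> (\<Sum>n. T (piece (int_decode n)) k)) at_top"
  proof (rule tannerys_theorem[THEN conjunct2, THEN conjunct2])
    show "((\<lambda>N. ?c n N) \<longlongrightarrow> T (piece (int_decode n)) k) at_top" for n
    proof -
      have "((\<lambda>N. \<integral>x. indicator {..N} x *\<^sub>R (K k x * piece (int_decode n) x) \<partial>lborel)
          \<longlongrightarrow> (\<integral>x. K k x * piece (int_decode n) x \<partial>lborel)) at_top"
        by (rule tendsto_integral_at_top) (auto intro: T_integrable piece_integrable)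
      moreover have "(\<integral>x. indicator {..N} x *\<^sub>R (K k x * piece (int_decode n) x) \<partial>lborel) = ?c n N" for N
        unfolding T_def by (intro Bochner_Integration.integral_cong) (auto simp: indicator_def)
      ultimately show ?thesis by (simp add: T_def)
    qed
    show "eventually (\<lambda>(n, N). norm (?c n N) \<le> enn2real (M n)) (at_top \<times>\<^sub>F at_top)"
    proof (intro always_eventually allI, clarify)
      fix n N
      have "ennreal (cmod (?c n N)) \<le> M n"
        unfolding M_def by (rule T_cutoff_le[OF piece_meas E_meas a_nonneg _ E_le piece_le]) simp
      then show "norm (?c n N) \<le> enn2real (M n)"
        using Mfin[of n] enn2real_mono[of "ennreal (cmod (?c n N))" "M n"] by simp
    qed
    show "summable (\<lambda>n. enn2real (M n))"
      using Mfin Msum by (intro summable_suminf_not_top) auto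
  qed simp
  moreover have "(\<Sum>n. ?c n N) = T (\<lambda>x. f x * indicator {..N} x) k" for N
    using T_cutoff_sums[OF assms(1)] by (simp add: sums_iff)
  ultimately show ?thesis by auto
qed

end

section \<open>Rearrangements and the Lorentz functional\<close>

text \<open>
  The distribution function of \<open>f\<close> on the half-line; the rearrangement is its generalized inverse.
\<close>
definition dist_fun :: "(real \<Rightarrow> complex) \<Rightarrow> ennreal \<Rightarrow> ennreal" where
  "dist_fun f s = emeasure lebesgue {x \<in> {0<..}. s < ennreal (cmod (f x))}"

lemma rearrangement_eq: "rearrangement f t = Inf {s. dist_fun f s \<le> ennreal t}"
  by (simp add: rearrangement_def dist_fun_def)

lemma rearrangement_antimono: "t \<le> u \<Longrightarrow> rearrangement f u \<le> rearrangement f t"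
  unfolding rearrangement_eq by (rule Inf_superset_mono) (auto intro: order_trans ennreal_leI)

lemma dist_fun_borel:
  assumes [measurable]: "f \<in> borel_measurable borel"
  shows "dist_fun f s = emeasure lborel {x. 0 < x \<and> s < ennreal (cmod (f x))}"
proof -
  have "{x. 0 < x \<and> s < ennreal (cmod (f x))} \<in> sets borel" by measurable
  then show ?thesis by (simp add: dist_fun_def greaterThan_def)
qed

text \<open>
  The infimum that defines the rearrangement is attained, since superlevel sets are continuous from
  below in the level.
\<close>
lemma dist_fun_rearrangement_le:
  assumes f [measurable]: "f \<in> borel_measurable borel"
  shows "dist_fun f (rearrangement f t) \<le> ennreal t"
proof -
  let ?A = "{s. dist_fun f s \<le> ennreal t}"
  let ?S = "\<lambda>s. {x. 0 < x \<and> s < ennreal (cmod (f x))}"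
  have "top \<in> ?A" by (simp add: dist_fun_def)
  then obtain s where s: "decseq s" "range s \<subseteq> ?A" "Inf ?A = (INF i. s i)"
    using ennreal_Inf_countable_INF[of ?A] by blast
  have "?S (Inf ?A) = (\<Union>i. ?S (s i))"
    unfolding s(3) by (auto simp: INF_less_iff)
  then have "dist_fun f (Inf ?A) = emeasure lborel (\<Union>i. ?S (s i))"
    by (simp add: dist_fun_borel[OF f])
  also have "\<dots> = (SUP i. emeasure lborel (?S (s i)))"
    using s(1) by (intro SUP_emeasure_incseq[symmetric]) (auto simp: incseq_def decseq_def intro: le_less_trans)
  also have "\<dots> \<le> ennreal t"
    using s(2) by (intro SUP_least) (auto simp: dist_fun_borel[OF f])
  finally show ?thesis by (simp add: rearrangement_eq)
qed

lemma less_rearrangementD: "s < rearrangement f t \<Longrightarrow> ennreal t < dist_fun f s"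
  unfolding rearrangement_eq by (metis (mono_tags, lifting) Inf_lower leD leI mem_Collect_eq)

lemma less_rearrangement_iff:
  assumes f [measurable]: "f \<in> borel_measurable borel"
  shows "s < rearrangement f t \<longleftrightarrow> ennreal t < dist_fun f s"
proof
  assume *: "ennreal t < dist_fun f s"
  show "s < rearrangement f t"
  proof (rule ccontr)
    assume "\<not> ?thesis"
    then have "dist_fun f s \<le> dist_fun f (rearrangement f t)"
      unfolding dist_fun_borel[OF f] by (intro emeasure_mono) (auto intro: le_less_trans)
    then show False using * dist_fun_rearrangement_le[OF f, of t] by simp
  qed
qed (rule less_rearrangementD)

lemma rearrangement_measurable:
  assumes f: "f \<in> borel_measurable borel"
  shows "rearrangement f \<in> borel_measurable borel"
proof (rule borel_measurableI_greater)
  fix s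
  have "{t. ennreal t < dist_fun f s} \<in> sets borel" by measurable
  then show "{x \<in> space borel. s < rearrangement f x} \<in> sets borel"
    by (simp add: less_rearrangement_iff[OF f])
qed

lemma rearrangement_le_avg:
  assumes "0 < t"
  shows "rearrangement f t \<le> rearrangement_avg f t"
proof -
  have "rearrangement f t = ennreal (1 / t) * (rearrangement f t * ennreal t)"
    using assms by (simp add: mult.left_commute flip: ennreal_mult)
  also have "rearrangement f t * ennreal t = (\<integral>\<^sup>+s. rearrangement f t \<partial>lebesgue_on {0<..<t})"
    using assms by (simp add: emeasure_restrict_space)
  also have "\<dots> \<le> (\<integral>\<^sup>+s. rearrangement f s \<partial>lebesgue_on {0<..<t})"
    by (intro nn_integral_mono rearrangement_antimono) auto
  finally show ?thesis
    unfolding rearrangement_avg_def by (simp add: mult_left_mono)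
qed

lemma lorentz_qnorm_le_norm:
  assumes "0 < q"
  shows "lorentz_qnorm p q f \<le> lorentz_norm p q f"
  unfolding lorentz_qnorm_def lorentz_norm_def lorentz_functional_def using assms
  by (intro epowr_mono mult_left_mono nn_integral_mono mult_right_mono)
     (auto intro!: mult_left_mono rearrangement_le_avg)

lemma nn_integral_lebesgue_on:
  assumes "S \<in> sets borel"
  shows "(\<integral>\<^sup>+x. g x \<partial>lebesgue_on S) = (\<integral>\<^sup>+x. g x * indicator S x \<partial>lebesgue)"
  using assms by (simp add: nn_integral_restrict_space)

definition lorentz_integral :: "real \<Rightarrow> real \<Rightarrow> (real \<Rightarrow> complex) \<Rightarrow> ennreal" where
  "lorentz_integral p q f =
    (\<integral>\<^sup>+t. epowr (ennreal (t powr (1 / p)) * rearrangement f t) q * ennreal (1 / t) \<partial>lebesgue_on {0<..})"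

text \<open>
  The rearrangement is at least \<open>f\<^sup>*(2^(j-1))\<close> on \<open>(2^(j-2), 2^(j-1)]\<close>, and these intervals are disjoint.
\<close>
lemma dyadic_sum_le_lorentz_integral:
  assumes q: "2 < q" and pq: "1 / q + 1 / p = 1"
  shows "(\<integral>\<^sup>+j. epowr (rearrangement f (2 powr (real_of_int j - 1))) q * ennreal (2 powr (real_of_int j * (q - 1))) \<partial>count_space UNIV)
    \<le> ennreal (2 powr (2 * (q - 1))) * lorentz_integral p q f"
proof -
  let ?I = "\<lambda>j::int. {2 powr (real_of_int j - 2)<..2 powr (real_of_int j - 1)}"
  define c where "c j = epowr (rearrangement f (2 powr (real_of_int j - 1))) q * ennreal (2 powr ((real_of_int j - 2) * (q - 2)))" for j :: int
  have p: "1 / p * q = q - 1" using q pq by (simp add: field_simps)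
  have c_le: "c j \<le> epowr (ennreal (t powr (1 / p)) * rearrangement f t) q * ennreal (1 / t)" if t: "t \<in> ?I j" for j t
  proof -
    have tpos: "0 < t" using t less_trans[of 0 "2 powr (real_of_int j - 2)" t] by auto
    have "2 powr ((real_of_int j - 2) * (q - 2)) \<le> t powr (q - 2)"
      using t q by (auto simp: powr_powr[symmetric] intro!: powr_mono2)
    then have "c j \<le> epowr (rearrangement f t) q * ennreal (t powr (q - 2))"
      unfolding c_def using t q by (intro mult_mono epowr_mono rearrangement_antimono ennreal_leI) auto
    also have "t powr (q - 2) = t powr (q - 1) * (1 / t)"
      using tpos by (simp add: powr_diff power2_eq_square)
    also have "ennreal (t powr (q - 1) * (1 / t)) = ennreal (t powr (q - 1)) * ennreal (1 / t)"
      using tpos by (intro ennreal_mult) auto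
    also have "epowr (rearrangement f t) q * (ennreal (t powr (q - 1)) * ennreal (1 / t))
        = epowr (ennreal (t powr (1 / p)) * rearrangement f t) q * ennreal (1 / t)"
      using q p by (simp add: epowr_mult epowr_ennreal powr_powr mult_ac)
    finally show ?thesis .
  qed
  have disj: "i = j" if "t \<in> ?I i" "t \<in> ?I j" for i j :: int and t
  proof -
    have "2 powr (real_of_int i - 2) < (2::real) powr (real_of_int j - 1)"
      "2 powr (real_of_int j - 2) < (2::real) powr (real_of_int i - 1)"
      using that by (meson greaterThanAtMost_iff less_le_trans)+
    then show ?thesis by simp
  qed
  have term_eq: "epowr (rearrangement f (2 powr (real_of_int j - 1))) q * ennreal (2 powr (real_of_int j * (q - 1)))
      = ennreal (2 powr (2 * (q - 1))) * (c j * emeasure lborel (?I j))" for j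
  proof -
    have "2 powr (real_of_int j - 1) = 2 * (2::real) powr (real_of_int j - 2)"
      using powr_add[of 2 1 "real_of_int j - 2"] by simp
    then have "emeasure lborel (?I j) = ennreal (2 powr (real_of_int j - 2))" by simp
    moreover have "2 powr (real_of_int j * (q - 1))
        = 2 powr (2 * (q - 1)) * (2 powr ((real_of_int j - 2) * (q - 2)) * (2::real) powr (real_of_int j - 2))"
      unfolding powr_add[symmetric] by (simp add: algebra_simps)
    ultimately show ?thesis by (simp add: c_def ennreal_mult mult_ac)
  qed
  have "(\<integral>\<^sup>+j. c j * emeasure lborel (?I j) \<partial>count_space UNIV)
      = (\<integral>\<^sup>+j. (\<integral>\<^sup>+t. c j * indicator (?I j) t \<partial>lborel) \<partial>count_space UNIV)"
    by (intro nn_integral_cong) (simp add: nn_integral_cmult)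
  also have "\<dots> = (\<integral>\<^sup>+t. (\<integral>\<^sup>+j. c j * indicator (?I j) t \<partial>count_space UNIV) \<partial>lborel)"
    unfolding nn_integral_count_space_int by (rule nn_integral_suminf[symmetric]) measurable
  also have "\<dots> = (\<integral>\<^sup>+t. (\<integral>\<^sup>+j. c j * indicator (?I j) t \<partial>count_space UNIV) \<partial>lebesgue)"
    unfolding nn_integral_count_space_int by (rule nn_integral_completion[symmetric]) 
  also have "\<dots> \<le> lorentz_integral p q f"
    unfolding lorentz_integral_def
  proof (subst nn_integral_lebesgue_on, simp, intro nn_integral_mono)
    fix t :: real
    let ?G = "epowr (ennreal (t powr (1 / p)) * rearrangement f t) q * ennreal (1 / t) * indicator {0<..} t"
    show "(\<integral>\<^sup>+j. c j * indicator (?I j) t \<partial>count_space UNIV) \<le> ?G"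
    proof (rule nn_integral_count_space_int_le)
      fix F :: "int set" assume F: "finite F"
      show "(\<Sum>j\<in>F. c j * indicator (?I j) t) \<le> ?G"
      proof (cases "\<exists>j\<in>F. t \<in> ?I j")
        case True
        then obtain j where j: "j \<in> F" "t \<in> ?I j" by blast
        have "(\<Sum>i\<in>F. c i * indicator (?I i) t) = (\<Sum>i\<in>{j}. c i * indicator (?I i) t)"
        proof (rule sum.mono_neutral_right[OF F])
          show "\<forall>i\<in>F - {j}. c i * indicator (?I i) t = 0"
            using disj[OF j(2)] by (metis DiffD2 indicator_simps(2) insertI1 mult_zero_right)
        qed (use j in auto)
        also have "\<dots> = c j" using j by simp
        also have "\<dots> \<le> ?G"
        proof -
          have "0 < t" using j(2) less_trans[of 0 "2 powr (real_of_int j - 2)" t] by auto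
          then show ?thesis using c_le[OF j(2)] by simp
        qed
        finally show ?thesis .
      next
        case False
        then have "(\<Sum>j\<in>F. c j * indicator (?I j) t) = 0" by (intro sum.neutral) auto
        then show ?thesis by simp
      qed
    qed
  qed
  finally have "ennreal (2 powr (2 * (q - 1))) * (\<integral>\<^sup>+j. c j * emeasure lborel (?I j) \<partial>count_space UNIV)
      \<le> ennreal (2 powr (2 * (q - 1))) * lorentz_integral p q f"
    by (rule mult_left_mono) simp
  then show ?thesis
    by (subst term_eq, subst nn_integral_cmult) auto
qed

lemma lorentz_integral_eq:
  assumes q: "2 < q" and p: "1 < p"
  shows "lorentz_integral p q f = ennreal (p / q) * epowr (lorentz_qnorm p q f) q"
proof -
  have "epowr (lorentz_qnorm p q f) q = ennreal (q / p) * lorentz_integral p q f"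
    using q by (simp add: lorentz_qnorm_def lorentz_functional_def lorentz_integral_def epowr_epowr)
  then show ?thesis
    using q p by (simp add: mult.assoc[symmetric] flip: ennreal_mult)
qed

lemma emeasure_below: "emeasure lborel {s::real. 0 < s \<and> ennreal s < y} = y"
proof (cases y)
  case (real r)
  then have "{s. 0 < s \<and> ennreal s < y} = {0<..<r}" by (auto simp: ennreal_less_iff)
  with real show ?thesis by simp
next
  case top
  then have eq: "{s. 0 < s \<and> ennreal s < y} = {0<..}" by auto
  have "ennreal (real n) \<le> emeasure lborel {0::real<..}" for n
    using emeasure_mono[of "{0<..<real n}" "{0<..}" lborel] by (simp add: subset_eq)
  then have "emeasure lborel {0::real<..} = top"
    using ennreal_Ex_less_of_nat[of "emeasure lborel {0::real<..}"]
    by (metis ennreal_of_nat_eq_real_of_nat leD less_top)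
  with eq top show ?thesis by simp
qed

text \<open>
  Both sides are integrals of distribution functions: \<open>s < f\<^sup>*(t)^p\<close> implies that \<open>\<bar>f\<bar>^p\<close> exceeds \<open>s\<close>
  on a set of measure greater than \<open>t\<close>.  Integrate over \<open>s\<close> and \<open>t\<close> and use Tonelli's theorem on both
  sides.
\<close>
lemma rearrangement_Lp_le:
  assumes f [measurable]: "f \<in> borel_measurable borel" and p: "0 < p"
  shows "(\<integral>\<^sup>+t. epowr (rearrangement f t) p \<partial>lebesgue_on {0<..})
    \<le> (\<integral>\<^sup>+x. ennreal (cmod (f x) powr p) * indicator {0<..} x \<partial>lborel)"
proof -
  let ?D = "\<lambda>s. \<integral>\<^sup>+x. indicator {x. 0 < x \<and> ennreal s < ennreal (cmod (f x) powr p)} x \<partial>lborel"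
  have D: "?D s = dist_fun f (ennreal (s powr (1 / p)))" if "0 < s" for s
  proof -
    have "ennreal s < ennreal (cmod (f x) powr p) \<longleftrightarrow> ennreal (s powr (1 / p)) < ennreal (cmod (f x))" for x
    proof -
      have "s < cmod (f x) powr p \<longleftrightarrow> s powr (1 / p) < cmod (f x)"
        using that p powr_less_mono2[of "1 / p" s "cmod (f x) powr p"] powr_less_mono2[of p "s powr (1 / p)" "cmod (f x)"]
        by (auto simp: powr_powr)
      then show ?thesis using that by (simp add: ennreal_less_iff)
    qed
    then show ?thesis by (simp add: dist_fun_borel[OF f])
  qed
  have [measurable]: "(\<lambda>s. ?D s) \<in> borel_measurable borel"
    by measurable
  have pw: "epowr (rearrangement f t) p * indicator {0<..} t
      \<le> (\<integral>\<^sup>+s. indicator {s. 0 < s \<and> 0 < t \<and> ennreal t < ?D s} s \<partial>lborel)" for t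
  proof (cases "0 < t")
    case True
    have "epowr (rearrangement f t) p = emeasure lborel {s::real. 0 < s \<and> ennreal s < epowr (rearrangement f t) p}"
      by (simp add: emeasure_below)
    also have "\<dots> \<le> emeasure lborel {s. 0 < s \<and> 0 < t \<and> ennreal t < ?D s}"
    proof (rule emeasure_mono)
      show "{s. 0 < s \<and> ennreal s < epowr (rearrangement f t) p} \<subseteq> {s. 0 < s \<and> 0 < t \<and> ennreal t < ?D s}"
      proof safe
        fix s :: real assume s: "0 < s" "ennreal s < epowr (rearrangement f t) p"
        have "ennreal (s powr (1 / p)) < rearrangement f t"
        proof (rule ccontr)
          assume "\<not> ?thesis"
          then have "epowr (rearrangement f t) p \<le> epowr (ennreal (s powr (1 / p))) p"
            using p by (intro epowr_mono) auto
          also have "\<dots> = ennreal s" using s p by (simp add: epowr_ennreal powr_powr)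
          finally show False using s by simp
        qed
        then show "ennreal t < ?D s"
          unfolding D[OF s(1)] by (rule less_rearrangementD)
      qed (use True in auto)
      show "{s. 0 < s \<and> 0 < t \<and> ennreal t < ?D s} \<in> sets lborel" by measurable
    qed
    finally show ?thesis using True by simp
  qed simp
  have "(\<integral>\<^sup>+t. epowr (rearrangement f t) p \<partial>lebesgue_on {0<..})
      \<le> (\<integral>\<^sup>+t. (\<integral>\<^sup>+s. indicator {s. 0 < s \<and> 0 < t \<and> ennreal t < ?D s} s \<partial>lborel) \<partial>lebesgue)"
    unfolding nn_integral_lebesgue_on[OF borel_open[OF open_greaterThan]] by (rule nn_integral_mono) (rule pw)
  also have "\<dots> = (\<integral>\<^sup>+t. (\<integral>\<^sup>+s. indicator {s. 0 < s \<and> 0 < t \<and> ennreal t < ?D s} s \<partial>lborel) \<partial>lborel)"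
    by (rule nn_integral_completion)
  also have "\<dots> = (\<integral>\<^sup>+t. (\<integral>\<^sup>+s. indicator {(s, t). 0 < s \<and> 0 < t \<and> ennreal t < ?D s} (s, t) \<partial>lborel) \<partial>lborel)"
    by (simp add: indicator_def)
  also have "\<dots> = (\<integral>\<^sup>+s. (\<integral>\<^sup>+t. indicator {(s, t). 0 < s \<and> 0 < t \<and> ennreal t < ?D s} (s, t) \<partial>lborel) \<partial>lborel)"
    by (rule lborel_pair.Fubini') measurable
  also have "\<dots> = (\<integral>\<^sup>+s. ?D s * indicator {0<..} s \<partial>lborel)"
  proof (rule nn_integral_cong)
    fix s :: real
    have "(\<integral>\<^sup>+t. indicator {(s, t). 0 < s \<and> 0 < t \<and> ennreal t < ?D s} (s, t) \<partial>lborel)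
        = (\<integral>\<^sup>+t. indicator {0<..} s * indicator {t. 0 < t \<and> ennreal t < ?D s} t \<partial>lborel)"
      by (intro nn_integral_cong) (auto simp: indicator_def)
    also have "\<dots> = indicator {0<..} s * emeasure lborel {t. 0 < t \<and> ennreal t < ?D s}"
      by (subst nn_integral_cmult) auto
    finally show "(\<integral>\<^sup>+t. indicator {(s, t). 0 < s \<and> 0 < t \<and> ennreal t < ?D s} (s, t) \<partial>lborel) = ?D s * indicator {0<..} s"
      by (simp add: emeasure_below mult.commute)
  qed
  also have "\<dots> = (\<integral>\<^sup>+s. (\<integral>\<^sup>+x. indicator {(x, s). 0 < s \<and> 0 < x \<and> ennreal s < ennreal (cmod (f x) powr p)} (x, s) \<partial>lborel) \<partial>lborel)"
  proof (rule nn_integral_cong)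
    fix s :: real
    have "?D s * indicator {0<..} s
      = (\<integral>\<^sup>+x. indicator {x. 0 < x \<and> ennreal s < ennreal (cmod (f x) powr p)} x * indicator {0<..} s \<partial>lborel)"
      by (subst nn_integral_multc) auto
    also have "\<dots> = (\<integral>\<^sup>+x. indicator {(x, s). 0 < s \<and> 0 < x \<and> ennreal s < ennreal (cmod (f x) powr p)} (x, s) \<partial>lborel)"
      by (intro nn_integral_cong) (auto simp: indicator_def)
    finally show "?D s * indicator {0<..} s = \<dots>" .
  qed
  also have "\<dots> = (\<integral>\<^sup>+x. (\<integral>\<^sup>+s. indicator {(x, s). 0 < s \<and> 0 < x \<and> ennreal s < ennreal (cmod (f x) powr p)} (x, s) \<partial>lborel) \<partial>lborel)"
    by (rule lborel_pair.Fubini') measurable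
  also have "\<dots> = (\<integral>\<^sup>+x. ennreal (cmod (f x) powr p) * indicator {0<..} x \<partial>lborel)"
  proof (rule nn_integral_cong)
    fix x :: real
    have "(\<integral>\<^sup>+s. indicator {(x, s). 0 < s \<and> 0 < x \<and> ennreal s < ennreal (cmod (f x) powr p)} (x, s) \<partial>lborel)
        = (\<integral>\<^sup>+s. indicator {0<..} x * indicator {s. 0 < s \<and> ennreal s < ennreal (cmod (f x) powr p)} s \<partial>lborel)"
      by (intro nn_integral_cong) (auto simp: indicator_def)
    also have "\<dots> = indicator {0<..} x * emeasure lborel {s. 0 < s \<and> ennreal s < ennreal (cmod (f x) powr p)}"
      by (subst nn_integral_cmult) auto
    finally show "(\<integral>\<^sup>+s. indicator {(x, s). 0 < s \<and> 0 < x \<and> ennreal s < ennreal (cmod (f x) powr p)} (x, s) \<partial>lborel)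
        = ennreal (cmod (f x) powr p) * indicator {0<..} x"
      by (simp add: emeasure_below mult.commute)
  qed
  finally show ?thesis .
qed

text \<open>
  Since \<open>f\<^sup>*\<close> is nonincreasing, \<open>t f\<^sup>*(t)^p \<le> \<integral> f\<^sup>*(s)^p ds \<le> P\<close>.  The integrand is
  \<open>(t f\<^sup>*(t)^p)^(q/p-1) f\<^sup>*(t)^p\<close>, so \<open>q / p - 1\<close> powers of \<open>P\<close> come out of the integral.
\<close>
lemma lorentz_integral_le_Lp:
  assumes f [measurable]: "f \<in> borel_measurable borel" and p: "0 < p" "p < q"
  defines "P \<equiv> \<integral>\<^sup>+x. ennreal (cmod (f x) powr p) * indicator {0<..} x \<partial>lborel"
  shows "lorentz_integral p q f \<le> epowr P (q / p)"
proof -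
  let ?r = "rearrangement f"
  define \<theta> where "\<theta> = q / p - 1"
  have \<theta>: "0 < \<theta>" "q = p + p * \<theta>" "q / p = \<theta> + 1" using p by (auto simp: \<theta>_def field_simps)
  have total: "(\<integral>\<^sup>+t. epowr (?r t) p \<partial>lebesgue_on {0<..}) \<le> P"
    unfolding P_def by (rule rearrangement_Lp_le[OF f p(1)])
  have cheb: "ennreal t * epowr (?r t) p \<le> P" if "0 < t" for t
  proof -
    have "ennreal t * epowr (?r t) p = (\<integral>\<^sup>+s. epowr (?r t) p * indicator {0<..<t} s \<partial>lebesgue)"
      using that by (subst nn_integral_cmult_indicator) (auto simp: mult.commute)
    also have "\<dots> \<le> (\<integral>\<^sup>+s. epowr (?r s) p * indicator {0<..} s \<partial>lebesgue)"
      using p by (intro nn_integral_mono) (auto simp: indicator_def intro!: epowr_mono rearrangement_antimono)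
    finally show ?thesis using total by (simp add: nn_integral_lebesgue_on)
  qed
  have "lorentz_integral p q f \<le> (\<integral>\<^sup>+t. epowr P \<theta> * epowr (?r t) p \<partial>lebesgue_on {0<..})"
    unfolding lorentz_integral_def
  proof (intro nn_integral_mono)
    fix t assume "t \<in> space (lebesgue_on {0::real<..})"
    then have t: "0 < t" by simp
    have "epowr (ennreal (t powr (1 / p)) * ?r t) q * ennreal (1 / t)
        = ennreal (t powr (q / p)) * ennreal (1 / t) * (epowr (?r t) p * epowr (?r t) (p * \<theta>))"
    proof -
      have "epowr (?r t) q = epowr (?r t) p * epowr (?r t) (p * \<theta>)"
        unfolding \<theta>(2) using p \<theta>(1) by (intro epowr_add) auto
      then show ?thesis
        using p by (simp add: epowr_mult epowr_ennreal powr_powr mult_ac)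
    qed
    also have "ennreal (t powr (q / p)) * ennreal (1 / t) = ennreal (t powr \<theta>)"
      using t by (simp add: \<theta>_def powr_diff flip: ennreal_mult)
    also have "ennreal (t powr \<theta>) * (epowr (?r t) p * epowr (?r t) (p * \<theta>))
        = epowr (ennreal t * epowr (?r t) p) \<theta> * epowr (?r t) p"
      using p \<theta>(1) t by (simp add: epowr_mult epowr_ennreal epowr_epowr mult_ac)
    also have "\<dots> \<le> epowr P \<theta> * epowr (?r t) p"
      using cheb[OF t] \<theta>(1) by (intro mult_right_mono epowr_mono) auto
    finally show "epowr (ennreal (t powr (1 / p)) * ?r t) q * ennreal (1 / t) \<le> epowr P \<theta> * epowr (?r t) p" .
  qed
  also have "\<dots> = epowr P \<theta> * (\<integral>\<^sup>+t. epowr (?r t) p \<partial>lebesgue_on {0<..})"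
  proof (rule nn_integral_cmult)
    have "(\<lambda>t. ?r t) \<in> borel_measurable lebesgue"
      using rearrangement_measurable[OF f] by (simp add: measurable_completion)
    then show "(\<lambda>t. epowr (?r t) p) \<in> borel_measurable (lebesgue_on {0<..})"
      by (intro measurable_epowr measurable_restrict_space1)
  qed
  also have "\<dots> \<le> epowr P \<theta> * P"
    by (intro mult_left_mono total) simp
  also have "\<dots> = epowr P (q / p)"
    using epowr_add[OF \<theta>(1), of 1 P] \<theta>(3) by simp
  finally show ?thesis .
qed

section \<open>The majorant of a function in a Lorentz space\<close>

lemma strictly_between_dyadic_index:
  fixes i j :: int
  assumes "P i" "\<not> P j" "j \<le> i"
  shows "\<exists>l. P l \<and> \<not> P (l - 1)"
proof (rule ccontr)
  assume "\<not> ?thesis"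
  then have step: "P (l - 1)" if "P l" for l using that by blast
  from \<open>j \<le> i\<close> have "P j" by (induction rule: int_le_induct) (auto intro: assms(1) step)
  with assms(2) show False by simp
qed

text \<open>
  The sets \<open>{f\<^sup>*(2^j) < \<bar>f\<bar> \<le> f\<^sup>*(2^(j-1))}\<close> decompose \<open>f\<close>.  They cover almost all of the support, because
  finiteness of the Lorentz integral forces \<open>f\<^sup>*(t) \<rightarrow> 0\<close> as \<open>t \<rightarrow> \<infinity>\<close>, and because \<open>\<bar>f\<bar>\<close> exceeds all values
  of \<open>f\<^sup>*\<close> only on a null set.
\<close>
lemma (in L2_kernel) lorentz_majorant:
  assumes f [measurable]: "f \<in> borel_measurable borel" and f0: "\<And>x. x \<le> 0 \<Longrightarrow> f x = 0"
    and q: "2 < q" and pq: "1 / q + 1 / p = 1" and fin: "lorentz_integral p q f < top"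
  shows "\<exists>H\<in>borel_measurable borel.
    (\<forall>N k. ennreal (cmod (T (\<lambda>x. f x * indicator {..N} x) k)) \<le> H k) \<and>
    (\<integral>\<^sup>+k. epowr (H k) q \<partial>lborel)
      \<le> ennreal (majorant_const q) * (ennreal (2 powr (2 * (q - 1))) * lorentz_integral p q f) \<and>
    (\<forall>k. H k < top \<longrightarrow> (\<exists>L. ((\<lambda>N. T (\<lambda>x. f x * indicator {..N} x) k) \<longlongrightarrow> L) at_top)) \<and>
    (\<forall>N. integrable lborel (\<lambda>x. f x * indicator {..N} x))"
proof -
  define r where "r j = rearrangement f (2 powr real_of_int j)" for j :: int
  define a where "a j = enn2real (r (j - 1))" for j
  define E where "E j = {x. 0 < x \<and> r j < ennreal (cmod (f x)) \<and> ennreal (cmod (f x)) \<le> r (j - 1)}" for j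
  let ?S = "\<integral>\<^sup>+j. epowr (r (j - 1)) q * ennreal (2 powr (real_of_int j * (q - 1))) \<partial>count_space UNIV"
  have S_le: "?S \<le> ennreal (2 powr (2 * (q - 1))) * lorentz_integral p q f"
    using dyadic_sum_le_lorentz_integral[OF q pq, of f] by (simp add: r_def)
  then have S_fin: "?S < top"
    using fin by (simp add: ennreal_mult_less_top le_less_trans)
  have r_mono: "i \<le> j \<Longrightarrow> r j \<le> r i" for i j
    unfolding r_def by (intro rearrangement_antimono) simp
  have term_le: "epowr (r (j - 1)) q * ennreal (2 powr (real_of_int j * (q - 1))) \<le> ?S" for j
    by (rule count_space_member_le)
  have r_fin: "r (j - 1) < top" for j
  proof (rule ccontr)
    assume "\<not> ?thesis"
    then have "r (j - 1) = top" using less_top by blast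
    then have "?S = top" using term_le[of j] by (simp add: ennreal_top_mult top_unique)
    with S_fin show False by simp
  qed
  then have ra: "r (j - 1) = ennreal (a j)" for j by (simp add: a_def)
  have a0: "0 \<le> a j" for j by (simp add: a_def)
  have term_eq: "epowr (r (j - 1)) q * ennreal (2 powr (real_of_int j * (q - 1)))
      = ennreal (a j powr q * 2 powr (real_of_int j * (q - 1)))" for j
    by (simp add: ra a0 epowr_ennreal ennreal_mult)
  \<comment> \<open>If \<open>c\<close> were a lower bound of the rearrangement, the terms of the convergent series would grow.\<close>
  have large: "\<exists>j\<ge>i. r j < ennreal c" if "0 < c" for c and i :: int
  proof (rule ccontr)
    assume "\<not> ?thesis"
    then have c_le: "ennreal c \<le> r j" if "i \<le> j" for j using that by (meson not_less)
    have c: "c \<le> a (j + 1)" if "i \<le> j" for j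
      using c_le[OF that] ra[of "j + 1"] a0[of "j + 1"] by (simp add: ennreal_le_iff)
    have le: "c powr q * real n \<le> enn2real ?S" if "i \<le> int n" for n
    proof -
      have "c powr q * real n \<le> a (int n + 1) powr q * 2 powr (real_of_int (int n + 1) * (q - 1))"
      proof (intro mult_mono powr_mono2 c[OF that])
        have "real n \<le> 2 ^ n" by (rule of_nat_less_two_power[THEN less_imp_le])
        also have "\<dots> = 2 powr real n" by (simp add: powr_realpow)
        also have "\<dots> \<le> 2 powr (real_of_int (int n + 1) * (q - 1))"
          using q mult_mono[of "real n" "real n + 1" 1 "q - 1"] by (intro powr_mono) auto
        finally show "real n \<le> 2 powr (real_of_int (int n + 1) * (q - 1))" .
      qed (use q that \<open>0 < c\<close> in auto)
      also have "\<dots> \<le> enn2real ?S"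
        using term_le[of "int n + 1"] enn2real_mono[OF _ S_fin] unfolding term_eq by fastforce
      finally show ?thesis .
    qed
    obtain n where n: "enn2real ?S < real n * c powr q"
      using reals_Archimedean3[of "c powr q"] \<open>0 < c\<close> by auto
    have "real n * c powr q \<le> real (max n (nat i)) * c powr q"
      by (intro mult_right_mono) auto
    also have "\<dots> \<le> enn2real ?S"
      unfolding mult.commute[of _ "c powr q"] by (rule le) linarith
    finally show False using n by simp
  qed
  have small: "AE x in lborel. 0 < x \<longrightarrow> (\<exists>j. ennreal (cmod (f x)) \<le> r j)"
  proof -
    let ?B = "{x. 0 < x \<and> (\<forall>j. r j < ennreal (cmod (f x)))}"
    have B: "?B \<in> sets borel" by measurable
    have le: "emeasure lborel ?B \<le> ennreal e" if e: "0 < e" for e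
    proof -
      obtain n where n: "(1 / 2) ^ n < e" using real_arch_pow_inv[of e "1 / 2"] e by auto
      have "emeasure lborel ?B \<le> dist_fun f (r (- int n))"
        unfolding dist_fun_borel[OF f] by (intro emeasure_mono) auto
      also have "\<dots> \<le> ennreal (2 powr real_of_int (- int n))"
        unfolding r_def by (rule dist_fun_rearrangement_le[OF f])
      also have "\<dots> \<le> ennreal e"
        using n by (intro ennreal_leI) (simp add: powr_minus powr_realpow power_one_over inverse_eq_divide)
      finally show ?thesis .
    qed
    have "emeasure lborel ?B \<le> 0" by (rule ennreal_le_epsilon) (simp add: le)
    then have "AE x in lborel. x \<notin> ?B"
      using B by (intro AE_not_in) (simp add: null_sets_def)
    then show ?thesis by eventually_elim (auto simp: not_less)
  qed
  interpret dyadic_decomposition K B C f E a q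
  proof
    show "E j \<in> sets borel" for j unfolding E_def by measurable
    show "i = j" if "x \<in> E i" "x \<in> E j" for x i j
    proof -
      have False if "x \<in> E i" "x \<in> E j" "i < j" for i j
        using that r_mono[of i "j - 1"] by (auto simp: E_def)
      with that show ?thesis by (metis linorder_neqE)
    qed
    show "AE x in lborel. f x \<noteq> 0 \<longrightarrow> (\<exists>j. x \<in> E j)"
      using small
    proof eventually_elim
      case (elim x)
      show ?case
      proof
        assume fx: "f x \<noteq> 0"
        then have x: "0 < x" using f0 by (meson not_less)
        with elim obtain j0 where j0: "ennreal (cmod (f x)) \<le> r j0" by blast
        obtain j1 where j1: "j0 \<le> j1" "r j1 < ennreal (cmod (f x))"
          using large[of "cmod (f x)" j0] fx by auto
        show "\<exists>j. x \<in> E j"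
          using strictly_between_dyadic_index[of "\<lambda>j. r j < ennreal (cmod (f x))" j1 j0] j0 j1 x
          by (auto simp: E_def not_less)
      qed
    qed
    show "emeasure lborel (E j) \<le> ennreal (2 powr real_of_int j)" for j
    proof -
      have "emeasure lborel (E j) \<le> dist_fun f (r j)"
        unfolding dist_fun_borel[OF f] by (intro emeasure_mono) (auto simp: E_def)
      also have "\<dots> \<le> ennreal (2 powr real_of_int j)"
        unfolding r_def by (rule dist_fun_rearrangement_le[OF f])
      finally show ?thesis .
    qed
    show "cmod (f x) \<le> a j" if "x \<in> E j" for x j
      using that ra[of j] a0[of j] by (simp add: E_def ennreal_le_iff)
  qed (simp_all add: E_def a0 q)
  have ws: "weight_sum = ?S" unfolding weight_sum_def term_eq ..
  have fin': "weight_sum < top" using S_fin by (simp add: ws)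
  show ?thesis
  proof (intro bexI[of _ majorant] conjI allI impI)
    show "ennreal (cmod (T (\<lambda>x. f x * indicator {..N} x) k)) \<le> majorant k" for N k
      by (rule T_cutoff_le_majorant[OF fin'])
    have "(\<integral>\<^sup>+k. epowr (majorant k) q \<partial>lborel) \<le> ennreal (majorant_const q) * weight_sum"
      unfolding weight_sum_def by (rule majorant_bound)
    also have "\<dots> \<le> ennreal (majorant_const q) * (ennreal (2 powr (2 * (q - 1))) * lorentz_integral p q f)"
      unfolding ws by (intro mult_left_mono S_le) simp
    finally show "(\<integral>\<^sup>+k. epowr (majorant k) q \<partial>lborel)
      \<le> ennreal (majorant_const q) * (ennreal (2 powr (2 * (q - 1))) * lorentz_integral p q f)" .
    show "\<exists>L. ((\<lambda>N. T (\<lambda>x. f x * indicator {..N} x) k) \<longlongrightarrow> L) at_top" if "majorant k < top" for k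
      by (rule T_cutoff_converges[OF fin' that])
    show "integrable lborel (\<lambda>x. f x * indicator {..N} x)" for N
      by (rule locally_integrable[OF fin'])
  qed (rule majorant_measurable)
qed

section \<open>From Lebesgue measurable to Borel functions\<close>

lemma completion_ex_borel_measurable_complex:
  fixes g :: "'a \<Rightarrow> complex"
  assumes g: "g \<in> borel_measurable (completion M)"
  shows "\<exists>g'\<in>borel_measurable M. AE x in M. g x = g' x"
proof -
  have "(\<lambda>x. Re (g x)) \<in> borel_measurable (completion M)" "(\<lambda>x. Im (g x)) \<in> borel_measurable (completion M)"
    using g by measurable
  from this[THEN completion_ex_borel_measurable_real]
  obtain u v where uv [measurable]: "u \<in> borel_measurable M" "v \<in> borel_measurable M"
    and eq: "AE x in M. Re (g x) = u x" "AE x in M. Im (g x) = v x"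
    by blast
  show ?thesis
  proof
    show "AE x in M. g x = Complex (u x) (v x)"
      using eq by eventually_elim (simp add: complex_eq_iff)
    show "(\<lambda>x. Complex (u x) (v x)) \<in> borel_measurable M"
      unfolding Complex_eq by measurable
  qed
qed

lemma lebesgue_integral_borel_version:
  fixes f F :: "real \<Rightarrow> complex"
  assumes F: "F \<in> borel_measurable borel" and eq: "AE x in lborel. f x = F x"
  shows "integral\<^sup>L lebesgue f = integral\<^sup>L lborel F" "integrable lebesgue f \<longleftrightarrow> integrable lborel F"
proof -
  have F': "F \<in> borel_measurable lborel" "F \<in> borel_measurable lebesgue"
    using F by (auto intro: measurable_completion)
  have eq': "AE x in lebesgue. F x = f x" using eq by (intro AE_completion) (auto simp: eq_commute)
  have f: "f \<in> borel_measurable lebesgue" by (rule borel_measurable_AE[OF F'(2) eq'])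
  show "integral\<^sup>L lebesgue f = integral\<^sup>L lborel F"
    using integral_cong_AE[OF F'(2) f eq'] integral_completion[OF F'(1)] by simp
  show "integrable lebesgue f \<longleftrightarrow> integrable lborel F"
    using integrable_cong_AE[OF F'(2) f eq'] integrable_completion[OF F'(1)] by simp
qed

lemma half_line_borel_version:
  fixes f :: "real \<Rightarrow> complex"
  assumes f: "f \<in> borel_measurable (lebesgue_on {0<..})"
  obtains F where "F \<in> borel_measurable borel" "\<And>x. x \<le> 0 \<Longrightarrow> F x = 0"
    "AE x in lborel. 0 < x \<longrightarrow> f x = F x"
proof -
  have "(\<lambda>x. if x \<in> {0<..} then f x else 0) \<in> borel_measurable lebesgue"
    by (rule borel_measurable_if_I[OF f]) simp
  then obtain G where G [measurable]: "G \<in> borel_measurable lborel"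
    and eq: "AE x in lborel. (if x \<in> {0<..} then f x else 0) = G x"
    using completion_ex_borel_measurable_complex by blast
  show ?thesis
  proof
    show "(\<lambda>x. if 0 < x then G x else 0) \<in> borel_measurable borel" using G by simp
    show "AE x in lborel. 0 < x \<longrightarrow> f x = (if 0 < x then G x else 0)"
      using eq by eventually_elim auto
  qed simp
qed

lemma dist_fun_cong_AE:
  assumes f: "f \<in> borel_measurable (lebesgue_on {0<..})" and F: "F \<in> borel_measurable borel"
    and eq: "AE x in lborel. 0 < x \<longrightarrow> f x = F x"
  shows "dist_fun f s = dist_fun F s"
  unfolding dist_fun_def
proof (rule emeasure_eq_AE)
  show "AE x in lebesgue. x \<in> {x \<in> {0<..}. s < ennreal (cmod (f x))} \<longleftrightarrow> x \<in> {x \<in> {0<..}. s < ennreal (cmod (F x))}"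
    using AE_completion[OF eq] by eventually_elim auto
  have sets: "{x \<in> {0<..}. s < ennreal (cmod (g x))} \<in> sets lebesgue"
    if g [measurable]: "g \<in> borel_measurable (lebesgue_on {0<..})" for g :: "real \<Rightarrow> complex"
  proof -
    have "{x \<in> space (lebesgue_on {0<..}). s < ennreal (cmod (g x))} \<in> sets (lebesgue_on {0<..})"
      by measurable
    then show ?thesis by (subst (asm) sets_restrict_space_iff) auto
  qed
  show "{x \<in> {0<..}. s < ennreal (cmod (f x))} \<in> sets lebesgue" by (rule sets[OF f])
  have "F \<in> borel_measurable (lebesgue_on {0<..})"
    using F by (intro measurable_restrict_space1 measurable_completion) simp
  then show "{x \<in> {0<..}. s < ennreal (cmod (F x))} \<in> sets lebesgue" by (rule sets)
qed

lemma nn_integral_half_line_borel_version: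
  fixes f F :: "real \<Rightarrow> complex"
  assumes eq: "AE x in lborel. 0 < x \<longrightarrow> f x = F x"
  shows "(\<integral>\<^sup>+x. g (f x) \<partial>lebesgue_on {0<..}) = (\<integral>\<^sup>+x. g (F x) * indicator {0<..} x \<partial>lborel)"
proof -
  have "(\<integral>\<^sup>+x. g (f x) \<partial>lebesgue_on {0<..}) = (\<integral>\<^sup>+x. g (f x) * indicator {0<..} x \<partial>lborel)"
    unfolding nn_integral_lebesgue_on[OF borel_open[OF open_greaterThan]] nn_integral_completion ..
  also have "\<dots> = (\<integral>\<^sup>+x. g (F x) * indicator {0<..} x \<partial>lborel)"
    using eq by (intro nn_integral_cong_AE, eventually_elim) (auto simp: indicator_def)
  finally show ?thesis .
qed

text \<open>
  The kernel is replaced by a Borel function that agrees with it almost everywhere in the plane, hence,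
  for almost every \<open>k\<close>, almost everywhere in \<open>x\<close>.  The constant \<open>max 0 C\<close> replaces \<open>C\<close> because a negative
  \<open>C\<close> acts as 0 in the hypothesis, while the locale uses \<open>C\<^sup>2\<close>.
\<close>
lemma L2_kernel_borel_version:
  fixes A :: "real \<Rightarrow> real \<Rightarrow> complex"
  assumes A_meas: "(\<lambda>(k, x). A k x) \<in> borel_measurable (lebesgue :: (real \<times> real) measure)"
    and A_bdd: "bounded (range (\<lambda>(k, x). A k x))"
    and T_L2: "\<And>f. f \<in> bounded_compact_support \<Longrightarrow>
      Lp_norm 2 lebesgue (integral_op A f) \<le> ennreal C * Lp_norm 2 (lebesgue_on {0<..}) f"
  obtains K B where "L2_kernel K B (max 0 C)" "AE k in lborel. AE x in lborel. A k x = K k x"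
proof -
  obtain B where B: "\<And>k x. cmod (A k x) \<le> B"
    using A_bdd by (auto simp: bounded_iff)
  obtain G where G [measurable]: "G \<in> borel_measurable (lborel :: (real \<times> real) measure)"
    and AG: "AE z in lborel. (case z of (k, x) \<Rightarrow> A k x) = G z"
    using completion_ex_borel_measurable_complex[OF A_meas] by blast
  define K where "K k x = (if cmod (G (k, x)) \<le> B then G (k, x) else 0)" for k x
  have B0: "0 \<le> B" using B[of 0 0] norm_ge_zero order_trans by blast
  have G' [measurable]: "G \<in> borel_measurable (lborel \<Otimes>\<^sub>M lborel)"
    using G by (simp only: lborel_prod)
  have K_meas: "(\<lambda>(k, x). K k x) \<in> borel_measurable (lborel \<Otimes>\<^sub>M lborel)"
    unfolding K_def by measurable
  have "AE z in (lborel \<Otimes>\<^sub>M lborel). (case z of (k, x) \<Rightarrow> A k x) = G z"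
    using AG by (simp only: lborel_prod)
  then have AG2: "AE k in lborel. AE x in lborel. A k x = G (k, x)"
    by (drule_tac lborel_pair.AE_pair) simp
  have AK: "AE k in lborel. AE x in lborel. A k x = K k x"
    using AG2
  proof eventually_elim
    case (elim k)
    then show ?case
    proof eventually_elim
      case (elim x)
      then show ?case using B[of k x] by (simp add: K_def)
    qed
  qed
  have sect: "K k \<in> borel_measurable borel" for k
  proof -
    have "(\<lambda>x. (\<lambda>(k, x). K k x) (k, x)) \<in> borel_measurable lborel"
      by (rule measurable_compose[OF measurable_Pair1' K_meas]) simp
    then show ?thesis by simp
  qed
  have "L2_kernel K B (max 0 C)"
  proof
    show "cmod (K k x) \<le> B" for k x using B0 by (simp add: K_def)
    fix g :: "real \<Rightarrow> complex" and l u :: real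
    assume g [measurable]: "g \<in> borel_measurable borel" and bdd: "bounded (range g)" and l: "0 < l"
      and supp: "\<And>x. x \<notin> {l..u} \<Longrightarrow> g x = 0"
    have g': "g \<in> borel_measurable (lebesgue_on {0<..})"
      using g by (intro measurable_restrict_space1 measurable_completion) simp
    have "g \<in> bounded_compact_support"
      unfolding bounded_compact_support_def using g' bdd l supp
      by (auto intro: bounded_subset intro!: exI[of _ "{l..u}"])
    note T_L2[OF this]
    moreover have "Lp_norm 2 lebesgue (integral_op A g)
        = epowr (\<integral>\<^sup>+k. (ennreal (cmod (LINT x|lborel. K k x * g x)))\<^sup>2 \<partial>lborel) (1 / 2)"
    proof -
      have "AE k in lborel. integral_op A g k = (LINT x|lborel. K k x * g x)"
        using AK
      proof eventually_elim
        case (elim k)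
        show ?case
          unfolding integral_op_def set_lebesgue_integral_def
        proof (rule lebesgue_integral_borel_version(1))
          show "(\<lambda>x. K k x * g x) \<in> borel_measurable borel" using sect[of k] by measurable
          show "AE x in lborel. indicator {0<..} x *\<^sub>R (A k x * g x) = K k x * g x"
            using elim
          proof eventually_elim
            case (elim x)
            then show ?case using supp[of x] l by (cases "0 < x") auto
          qed
        qed
      qed
      then have "(\<integral>\<^sup>+k. epowr (ennreal (cmod (integral_op A g k))) 2 \<partial>lborel)
          = (\<integral>\<^sup>+k. (ennreal (cmod (LINT x|lborel. K k x * g x)))\<^sup>2 \<partial>lborel)"
        by (intro nn_integral_cong_AE, eventually_elim) (simp add: epowr_2)
      then show ?thesis by (simp add: eLp_norm_def nn_integral_completion)
    qed
    moreover have "Lp_norm 2 (lebesgue_on {0<..}) g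
        = epowr (\<integral>\<^sup>+x. (ennreal (cmod (g x)))\<^sup>2 \<partial>lborel) (1 / 2)"
    proof -
      have "(ennreal (cmod (g x)))\<^sup>2 * indicator {0<..} x = (ennreal (cmod (g x)))\<^sup>2" for x
        using supp[of x] l by (cases "0 < x") auto
      then show ?thesis
        by (simp add: eLp_norm_def nn_integral_lebesgue_on nn_integral_completion epowr_2)
    qed
    ultimately have le: "epowr (\<integral>\<^sup>+k. (ennreal (cmod (LINT x|lborel. K k x * g x)))\<^sup>2 \<partial>lborel) (1 / 2)
        \<le> ennreal C * epowr (\<integral>\<^sup>+x. (ennreal (cmod (g x)))\<^sup>2 \<partial>lborel) (1 / 2)"
      by simp
    have "ennreal C = ennreal (max 0 C)" by (simp add: max_def ennreal_neg)
    with epowr_mono[OF le, of 2]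
    show "(\<integral>\<^sup>+k. (ennreal (cmod (LINT x|lborel. K k x * g x)))\<^sup>2 \<partial>lborel)
        \<le> ennreal ((max 0 C)\<^sup>2) * (\<integral>\<^sup>+x. (ennreal (cmod (g x)))\<^sup>2 \<partial>lborel)"
      by (simp add: epowr_epowr epowr_mult epowr_ennreal)
  qed (rule K_meas)
  with AK show ?thesis by (rule that[rotated])
qed

lemma (in L2_kernel) partial_integral_eq_T:
  assumes AK: "AE x in lborel. A k x = K k x"
    and F [measurable]: "F \<in> borel_measurable borel" "\<And>x. x \<le> 0 \<Longrightarrow> F x = 0"
    and eq: "AE x in lborel. 0 < x \<longrightarrow> f x = F x"
  shows "partial_integral A f k N = T (\<lambda>x. F x * indicator {..N} x) k"
    and "set_integrable lebesgue {0<..N} (\<lambda>x. A k x * f x) \<longleftrightarrow>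
      integrable lborel (\<lambda>x. K k x * (F x * indicator {..N} x))"
proof -
  have "AE x in lborel. indicator {0<..N} x *\<^sub>R (A k x * f x) = K k x * (F x * indicator {..N} x)"
    using AK eq
  proof eventually_elim
    case (elim x)
    then show ?case using F(2)[of x] by (cases "0 < x") (auto simp: indicator_def)
  qed
  note * = lebesgue_integral_borel_version[OF _ this]
  show "partial_integral A f k N = T (\<lambda>x. F x * indicator {..N} x) k"
    unfolding partial_integral_def set_lebesgue_integral_def T_def by (rule *(1)) measurable
  show "set_integrable lebesgue {0<..N} (\<lambda>x. A k x * f x) \<longleftrightarrow>
      integrable lborel (\<lambda>x. K k x * (F x * indicator {..N} x))"
    unfolding set_integrable_def by (rule *(2)) measurable
qed

section \<open>The maximal inequality and convergence\<close>

lemma (in L2_kernel) maximal_op_lorentz: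
  assumes AK: "AE k in lborel. AE x in lborel. A k x = K k x"
    and q: "2 < q" and pq: "1 / q + 1 / p = 1"
    and f: "f \<in> borel_measurable (lebesgue_on {0<..})" and fin: "lorentz_integral p q f < top"
  shows "eLp_norm q lebesgue (maximal_op A f)
      \<le> epowr (ennreal (majorant_const q) * (ennreal (2 powr (2 * (q - 1))) * lorentz_integral p q f)) (1 / q)"
    and "AE k in lebesgue. integral_converges A f k"
proof -
  obtain F where F: "F \<in> borel_measurable borel" "\<And>x. x \<le> 0 \<Longrightarrow> F x = 0"
    and eq: "AE x in lborel. 0 < x \<longrightarrow> f x = F x"
    using half_line_borel_version[OF f] by blast
  have "lorentz_integral p q f = lorentz_integral p q F"
    unfolding lorentz_integral_def rearrangement_eq dist_fun_cong_AE[OF f F(1) eq] ..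
  with fin lorentz_majorant[OF F q pq] obtain H where H [measurable]: "H \<in> borel_measurable borel"
    and le: "\<And>N k. ennreal (cmod (T (\<lambda>x. F x * indicator {..N} x) k)) \<le> H k"
    and int: "(\<integral>\<^sup>+k. epowr (H k) q \<partial>lborel)
      \<le> ennreal (majorant_const q) * (ennreal (2 powr (2 * (q - 1))) * lorentz_integral p q f)" (is "_ \<le> ?R")
    and conv: "\<And>k. H k < top \<Longrightarrow> \<exists>L. ((\<lambda>N. T (\<lambda>x. F x * indicator {..N} x) k) \<longlongrightarrow> L) at_top"
    and loc: "\<And>N. integrable lborel (\<lambda>x. F x * indicator {..N} x)"
    by auto
  have "AE k in lborel. epowr (maximal_op A f k) q \<le> epowr (H k) q"
    using AK
  proof eventually_elim
    case (elim k)
    have "partial_integral A f k N = T (\<lambda>x. F x * indicator {..N} x) k" for N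
      by (rule partial_integral_eq_T(1)) (fact elim F eq)+
    then have "maximal_op A f k \<le> H k"
      unfolding maximal_op_def by (simp only:) (intro SUP_least le)
    then show ?case using q by (intro epowr_mono) auto
  qed
  then have "(\<integral>\<^sup>+k. epowr (maximal_op A f k) q \<partial>lborel) \<le> ?R"
    by (rule order_trans[OF nn_integral_mono_AE int])
  then show "eLp_norm q lebesgue (maximal_op A f) \<le> epowr ?R (1 / q)"
    unfolding eLp_norm_def nn_integral_completion using q by (intro epowr_mono) auto
  have "?R < top" using fin by (simp add: ennreal_mult_less_top)
  with int have "(\<integral>\<^sup>+k. epowr (H k) q \<partial>lborel) < top" by simp
  then have "AE k in lborel. epowr (H k) q \<noteq> \<infinity>"
    by (intro nn_integral_PInf_AE) auto
  then have "AE k in lborel. H k < top"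
    by eventually_elim (simp add: top.not_eq_extremum)
  with AK have "AE k in lborel. integral_converges A f k"
  proof eventually_elim
    case (elim k)
    have "partial_integral A f k = (\<lambda>N. T (\<lambda>x. F x * indicator {..N} x) k)"
      by (rule ext, rule partial_integral_eq_T(1)) (fact elim F eq)+
    moreover have "set_integrable lebesgue {0<..N} (\<lambda>x. A k x * f x)" for N
      using partial_integral_eq_T(2)[where A = A and k = k and f = f and F = F and N = N]
        T_integrable[OF loc] elim F eq by simp
    ultimately show ?case
      unfolding integral_converges_def using conv[OF elim(2)] by simp
  qed
  then show "AE k in lebesgue. integral_converges A f k" by (rule AE_completion)
qed

text \<open>
  For an integrable \<open>f\<close> the integral converges absolutely, whenever \<open>A k\<close> agrees with \<open>K k\<close> almost
  everywhere.
\<close>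
lemma (in L2_kernel) integral_converges_L1:
  assumes AK: "AE k in lborel. AE x in lborel. A k x = K k x" and f: "f \<in> Lp_space 1"
  shows "AE k in lebesgue. integral_converges A f k"
proof -
  have fm: "f \<in> borel_measurable (lebesgue_on {0<..})"
    and f1: "(\<integral>\<^sup>+x. ennreal (cmod (f x)) \<partial>lebesgue_on {0<..}) < top"
    using f by (auto simp: Lp_space_def eLp_norm_def)
  obtain F where F [measurable]: "F \<in> borel_measurable borel" and F0: "\<And>x. x \<le> 0 \<Longrightarrow> F x = 0"
    and eq: "AE x in lborel. 0 < x \<longrightarrow> f x = F x"
    using half_line_borel_version[OF fm] by blast
  have "(\<integral>\<^sup>+x. ennreal (cmod (F x)) \<partial>lborel) = (\<integral>\<^sup>+x. ennreal (cmod (F x)) * indicator {0<..} x \<partial>lborel)"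
    using F0 by (intro nn_integral_cong) (auto simp: indicator_def not_less)
  then have "integrable lborel F"
    using f1 nn_integral_half_line_borel_version[OF eq, of "\<lambda>z. ennreal (cmod z)"]
    by (intro integrableI_bounded) auto
  then have KF: "integrable lborel (\<lambda>x. K k x * F x)" for k by (rule T_integrable)
  have cut: "(\<lambda>x. K k x * (F x * indicator {..N} x)) = (\<lambda>x. indicator {..N} x *\<^sub>R (K k x * F x))" for k N
    by (auto simp: indicator_def)
  have "AE k in lborel. integral_converges A f k"
    using AK
  proof eventually_elim
    case (elim k)
    have "((\<lambda>N. T (\<lambda>x. F x * indicator {..N} x) k) \<longlongrightarrow> (LINT x|lborel. K k x * F x)) at_top"
      unfolding T_def cut by (rule tendsto_integral_at_top) (simp_all add: KF)
    moreover have "integrable lborel (\<lambda>x. K k x * (F x * indicator {..N} x))" for N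
      unfolding cut by (rule integrable_mult_indicator) (simp_all add: KF)
    moreover have "partial_integral A f k = (\<lambda>N. T (\<lambda>x. F x * indicator {..N} x) k)"
      by (rule ext, rule partial_integral_eq_T(1)) (fact elim F F0 eq)+
    moreover have "set_integrable lebesgue {0<..N} (\<lambda>x. A k x * f x) \<longleftrightarrow>
        integrable lborel (\<lambda>x. K k x * (F x * indicator {..N} x))" for N
      by (rule partial_integral_eq_T(2)) (fact elim F F0 eq)+
    ultimately show ?case
      unfolding integral_converges_def by auto
  qed
  then show ?thesis by (rule AE_completion)
qed

lemma Lp_space_lorentz_integral_le:
  assumes f: "f \<in> Lp_space p" and p: "0 < p" "p < q"
  shows "lorentz_integral p q f \<le> epowr (Lp_norm p (lebesgue_on {0<..}) f) q"
proof -
  have fm: "f \<in> borel_measurable (lebesgue_on {0<..})" using f by (simp add: Lp_space_def)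
  obtain F where F: "F \<in> borel_measurable borel"
    and eq: "AE x in lborel. 0 < x \<longrightarrow> f x = F x"
    using half_line_borel_version[OF fm] by blast
  have "lorentz_integral p q f = lorentz_integral p q F"
    unfolding lorentz_integral_def rearrangement_eq dist_fun_cong_AE[OF fm F(1) eq] ..
  also have "\<dots> \<le> epowr (\<integral>\<^sup>+x. ennreal (cmod (F x) powr p) * indicator {0<..} x \<partial>lborel) (q / p)"
    by (rule lorentz_integral_le_Lp[OF F p])
  also have "(\<integral>\<^sup>+x. ennreal (cmod (F x) powr p) * indicator {0<..} x \<partial>lborel)
      = (\<integral>\<^sup>+x. epowr (ennreal (cmod (f x))) p \<partial>lebesgue_on {0<..})"
    using nn_integral_half_line_borel_version[OF eq, of "\<lambda>z. ennreal (cmod z powr p)"]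
    by (simp add: epowr_ennreal)
  also have "epowr \<dots> (q / p) = epowr (Lp_norm p (lebesgue_on {0<..}) f) q"
    using p by (simp add: eLp_norm_def epowr_epowr)
  finally show ?thesis .
qed

theorem theorem2p1:
  fixes A :: "real \<Rightarrow> real \<Rightarrow> complex" and C :: real
  assumes A_meas: "(\<lambda>(k, x). A k x) \<in> borel_measurable (lebesgue :: (real \<times> real) measure)"
    and A_bdd: "bounded (range (\<lambda>(k, x). A k x))"
    and T_L2: "\<And>f. f \<in> bounded_compact_support \<Longrightarrow>
      Lp_norm 2 lebesgue (integral_op A f) \<le> ennreal C * Lp_norm 2 (lebesgue_on {0<..}) f"
  shows "(\<forall>q p :: real. q > 2 \<and> 1 / q + 1 / p = 1 \<longrightarrow>
            (\<exists>Cq :: real. \<forall>f\<in>lorentz_space p q.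
               eLp_norm q lebesgue (maximal_op A f) \<le> ennreal Cq * lorentz_norm p q f) \<and>
            (\<exists>Cq :: real. \<forall>f\<in>Lp_space p.
               eLp_norm q lebesgue (maximal_op A f) \<le> ennreal Cq * Lp_norm p (lebesgue_on {0<..}) f) \<and>
            (\<forall>f\<in>lorentz_space p q. AE k in lebesgue. integral_converges A f k)) \<and>
         (\<forall>p :: real. 1 \<le> p \<and> p < 2 \<longrightarrow>
            (\<forall>f\<in>Lp_space p. AE k in lebesgue. integral_converges A f k))"
proof -
  obtain K B where L2: "L2_kernel K B (max 0 C)" and AK: "AE k in lborel. AE x in lborel. A k x = K k x"
    using L2_kernel_borel_version[OF A_meas A_bdd T_L2] by blast
  interpret L2_kernel K B "max 0 C" by (rule L2)
  define D where "D q = majorant_const q * 2 powr (2 * (q - 1))" for q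
  have D0: "0 \<le> D q" if "2 < q" for q
    using that B_nonneg by (simp add: D_def majorant_const_def geom_sum_nonneg)
  have bound: "eLp_norm q lebesgue (maximal_op A f) \<le> ennreal (D q powr (1 / q)) * epowr (lorentz_integral p q f) (1 / q)"
    if q: "2 < q" "1 / q + 1 / p = 1" and f: "f \<in> borel_measurable (lebesgue_on {0<..})"
      "lorentz_integral p q f < top" for p q f
  proof -
    have "eLp_norm q lebesgue (maximal_op A f) \<le> epowr (ennreal (D q) * lorentz_integral p q f) (1 / q)"
      using maximal_op_lorentz(1)[OF AK q f] D0[OF q(1)]
      by (simp add: D_def ennreal_mult'' mult.assoc)
    then show ?thesis
      using q D0[OF q(1)] by (simp add: epowr_mult epowr_ennreal)
  qed
  have exponents: "1 < p" "p < 2" if "2 < q" "1 / q + 1 / p = 1" for p q :: real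
  proof -
    have "1 / p = 1 - 1 / q" "0 < 1 / q" "1 / q < 1 / 2" using that by auto
    then have *: "1 / 2 < 1 / p" "1 / p < 1" by linarith+
    then have "0 < p" by (metis less_trans zero_less_divide_1_iff half_gt_zero_iff zero_less_one)
    with * show "1 < p" "p < 2" by (simp_all add: field_simps)
  qed
  have lorentz: "f \<in> borel_measurable (lebesgue_on {0<..})"
    "lorentz_integral p q f = ennreal (p / q) * epowr (lorentz_qnorm p q f) q"
    "lorentz_integral p q f < top"
    if q: "2 < q" "1 / q + 1 / p = 1" and f: "f \<in> lorentz_space p q" for p q f
  proof -
    show "f \<in> borel_measurable (lebesgue_on {0<..})" using f by (simp add: lorentz_space_def)
    show eq: "lorentz_integral p q f = ennreal (p / q) * epowr (lorentz_qnorm p q f) q"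
      using lorentz_integral_eq exponents[OF q] q by blast
    have "epowr (lorentz_qnorm p q f) q < top"
      using f by (simp add: lorentz_space_def less_top[symmetric])
    then show "lorentz_integral p q f < top"
      unfolding eq by (simp add: ennreal_mult_less_top)
  qed
  have Lp: "f \<in> borel_measurable (lebesgue_on {0<..})"
    "lorentz_integral p q f \<le> epowr (Lp_norm p (lebesgue_on {0<..}) f) q"
    "lorentz_integral p q f < top"
    if q: "2 < q" "1 / q + 1 / p = 1" and f: "f \<in> Lp_space p" for p q f
  proof -
    show "f \<in> borel_measurable (lebesgue_on {0<..})" using f by (simp add: Lp_space_def)
    show le: "lorentz_integral p q f \<le> epowr (Lp_norm p (lebesgue_on {0<..}) f) q"
      using Lp_space_lorentz_integral_le[OF f] exponents[OF q] q by auto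
    have "epowr (Lp_norm p (lebesgue_on {0<..}) f) q < top"
      using f by (simp add: Lp_space_def less_top[symmetric])
    with le show "lorentz_integral p q f < top" by simp
  qed
  show ?thesis
  proof (intro conjI allI impI ballI, goal_cases)
    case (1 q p)
    then have q: "2 < q" "1 / q + 1 / p = 1" by auto
    show ?case
    proof (intro exI ballI)
      fix f assume f: "f \<in> lorentz_space p q"
      have "epowr (lorentz_integral p q f) (1 / q) = ennreal ((p / q) powr (1 / q)) * lorentz_qnorm p q f"
        using q exponents[OF q] by (simp add: lorentz(2)[OF q f] epowr_mult epowr_epowr epowr_ennreal)
      also have "\<dots> \<le> ennreal ((p / q) powr (1 / q)) * lorentz_norm p q f"
        using q by (intro mult_left_mono lorentz_qnorm_le_norm) auto
      finally have "ennreal (D q powr (1 / q)) * epowr (lorentz_integral p q f) (1 / q)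
          \<le> ennreal (D q powr (1 / q)) * (ennreal ((p / q) powr (1 / q)) * lorentz_norm p q f)"
        by (rule mult_left_mono) simp
      with bound[OF q lorentz(1,3)[OF q f]]
      show "eLp_norm q lebesgue (maximal_op A f)
          \<le> ennreal (D q powr (1 / q) * (p / q) powr (1 / q)) * lorentz_norm p q f"
        by (simp add: ennreal_mult mult.assoc)
    qed
  next
    case (2 q p)
    then have q: "2 < q" "1 / q + 1 / p = 1" by auto
    show ?case
    proof (intro exI ballI)
      fix f assume f: "f \<in> Lp_space p"
      have "epowr (lorentz_integral p q f) (1 / q) \<le> Lp_norm p (lebesgue_on {0<..}) f"
        using epowr_mono[OF Lp(2)[OF q f], of "1 / q"] q by (simp add: epowr_epowr)
      then have "ennreal (D q powr (1 / q)) * epowr (lorentz_integral p q f) (1 / q)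
          \<le> ennreal (D q powr (1 / q)) * Lp_norm p (lebesgue_on {0<..}) f"
        by (rule mult_left_mono) simp
      with bound[OF q Lp(1,3)[OF q f]]
      show "eLp_norm q lebesgue (maximal_op A f) \<le> ennreal (D q powr (1 / q)) * Lp_norm p (lebesgue_on {0<..}) f"
        by simp
    qed
  next
    case (3 q p f)
    then have q: "2 < q" "1 / q + 1 / p = 1" by auto
    show ?case by (rule maximal_op_lorentz(2)[OF AK q lorentz(1,3)[OF q 3(2)]])
  next
    case (4 p f)
    show ?case
    proof (cases "p = 1")
      case True
      with 4 show ?thesis by (intro integral_converges_L1[OF AK]) simp
    next
      case False
      define q where "q = p / (p - 1)"
      have q: "2 < q" "1 / q + 1 / p = 1"
        using 4 False by (auto simp: q_def field_simps)
      show ?thesis by (rule maximal_op_lorentz(2)[OF AK q Lp(1,3)[OF q 4(2)]])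
    qed
  qed
qed

end
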